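(* Let $\mathcal{A}=\bigcup_p \Phi_p'$ be a strong algebra (as defined in the context). Then the multiplication is a continuous function $\mathcal{A}\times\mathcal{A}\to\mathcal{A}$ in the strong topology. Hence $(\mathcal{A},+,\cdot)$ is a topological $\mathbb{C}$-algebra.
   Context: A countably normed space $\Phi$ is a locally convex (complex) space whose topology is defined by a countable family of compatible norms $(\|\cdot\|_p)_{p\in\mathbb N}$, i.e. if a sequence that is Cauchy in both $\|\cdot\|_p$ and $\|\cdot\|_q$ converges to zero in one of these norms, then it converges to zero in the other; the sequence of norms is taken non-decreasing in $p$. $\Phi_p$ denotes the completion of $\Phi$ with respect to $\|\cdot\|_p$, so $\Phi_1\supseteq\Phi_2\supseteq\cdots$, and $\Phi$ is complete iff $\Phi=\bigcap_p\Phi_p$. $\Phi'$ is the dual of $\Phi$ and $\Phi_p'$ the Banach dual of $\Phi_p$, with norm $\|f\|_p=\sup_{\|x\|_p\le 1}|f(x)|$; then $\Phi_1'\subseteq\Phi_2'\subseteq\cdots$, $\Phi'=\bigcup_p\Phi_p'$, and these dual norms are non-increasing in $p$. Strong algebra: a dual $\mathcal A=\bigcup_p\Phi_p'$ of a complete reflexive countably normed space $\Phi$, which is moreover an algebra over $\mathbb C$, such that there exists a constant $d$ such that for any $q$ and any $p>q+d$ there exists a positive constant $A_{p,q}$ such that for any $a\in\Phi_q'$ and $b\in\Phi_p'$: $\|ab\|_p\le A_{p,q}\|a\|_q\|b\|_p$ and $\|ba\|_p\le A_{p,q}\|a\|_q\|b\|_p$. Strong topology on $\mathcal A$: a base of neighborhoods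 of zero is given by the sets $\{a\in\mathcal A:\sup_{b\in B}|a(b)|<\epsilon\}$, for $B\subseteq\bigcap_p\Phi_p$ bounded and $\epsilon>0$. (It coincides with the locally convex inductive limit topology of the Banach spaces $\Phi_p'$.) *)

theory Defs
  imports "HOL-Analysis.Analysis" "HOL-Library.Function_Algebras"
begin

section \<open>Locally convex topologies given by seminorms, and strong duals\<close>

text \<open>
  All spaces are carriers \<open>S\<close> of complex vector spaces inside a type, with an explicit scalar
  multiplication. \<open>P\<close> is the family of (semi)norms defining the topology. The generating sets are
  the translates of the seminorm balls around zero.
\<close>

definition lc_topology :: "'v::ab_group_add set \<Rightarrow> ('v \<Rightarrow> real) set \<Rightarrow> 'v topology" where
  "lc_topology S P =
     topology_generated_by {{y \<in> S. p (y - x) < e} | x p e. x \<in> S \<and> p \<in> P \<and> 0 < e}"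

definition lc_bounded :: "'v set \<Rightarrow> ('v \<Rightarrow> real) set \<Rightarrow> 'v set \<Rightarrow> bool" where
  "lc_bounded S P B \<longleftrightarrow> B \<subseteq> S \<and> (\<forall>p\<in>P. bdd_above (p ` B))"

text \<open>
  Functionals on a proper carrier are taken to be extensional (\<open>undefined\<close> outside), so that equal
  functionals are equal as HOL functions; for \<open>S = UNIV\<close> this is no restriction.
\<close>

definition linear_functional_on ::
    "(complex \<Rightarrow> 'v \<Rightarrow> 'v) \<Rightarrow> 'v::ab_group_add set \<Rightarrow> ('v \<Rightarrow> complex) \<Rightarrow> bool" where
  "linear_functional_on smul S f \<longleftrightarrow>
     (\<forall>x\<in>S. \<forall>y\<in>S. f (x + y) = f x + f y) \<and> (\<forall>c. \<forall>x\<in>S. f (smul c x) = c * f x)"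

definition continuous_dual ::
    "(complex \<Rightarrow> 'v \<Rightarrow> 'v) \<Rightarrow> 'v::ab_group_add set \<Rightarrow> ('v \<Rightarrow> real) set \<Rightarrow> ('v \<Rightarrow> complex) set" where
  "continuous_dual smul S P =
     {f \<in> extensional S. linear_functional_on smul S f
        \<and> continuous_map (lc_topology S P) euclidean f}"

text \<open>
  The strong topology on a space of functionals on \<open>S\<close> has as zero neighbourhoods the sets
  \<open>{f. (SUP x\<in>B. cmod (f x)) < e}\<close> with \<open>B\<close> bounded. The empty set is left out because \<open>Sup {}\<close> is
  unspecified on the reals; it would only contribute the whole space.
\<close>

definition strong_seminorms :: "'v set \<Rightarrow> ('v \<Rightarrow> real) set \<Rightarrow> (('v \<Rightarrow> complex) \<Rightarrow> real) set" where
  "strong_seminorms S P = {\<lambda>f. SUP x\<in>B. cmod (f x) | B. lc_bounded S P B \<and> B \<noteq> {}}"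

definition fun_scale :: "complex \<Rightarrow> ('v \<Rightarrow> complex) \<Rightarrow> 'v \<Rightarrow> complex" where
  "fun_scale c f = (\<lambda>x. c * f x)"

text \<open>The canonical map into the strong bidual is an isomorphism of topological vector spaces.\<close>

definition lc_reflexive ::
    "(complex \<Rightarrow> 'v \<Rightarrow> 'v) \<Rightarrow> 'v::ab_group_add set \<Rightarrow> ('v \<Rightarrow> real) set \<Rightarrow> bool" where
  "lc_reflexive smul S P \<longleftrightarrow>
     (let D = continuous_dual smul S P;
          Q = strong_seminorms S P
      in homeomorphic_map (lc_topology S P)
           (lc_topology (continuous_dual fun_scale D Q) (strong_seminorms D Q))
           (\<lambda>x. \<lambda>f\<in>D. f x))"


section \<open>Norms, completions and Banach duals\<close>

locale complex_norm = vector_space smul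
  for smul :: "complex \<Rightarrow> 'a::ab_group_add \<Rightarrow> 'a" +
  fixes N :: "'a \<Rightarrow> real"
  assumes eq_0_iff: "N x = 0 \<longleftrightarrow> x = 0"
    and triangle: "N (x + y) \<le> N x + N y"
    and norm_smul: "N (smul c x) = cmod c * N x"

definition norm_Cauchy :: "('a::ab_group_add \<Rightarrow> real) \<Rightarrow> (nat \<Rightarrow> 'a) \<Rightarrow> bool" where
  "norm_Cauchy N X \<longleftrightarrow> (\<forall>e>0. \<exists>M. \<forall>m\<ge>M. \<forall>n\<ge>M. N (X m - X n) < e)"

text \<open>The completion with respect to \<open>N\<close>: Cauchy sequences modulo null sequences.\<close>

definition completion_rel :: "('a::ab_group_add \<Rightarrow> real) \<Rightarrow> ((nat \<Rightarrow> 'a) \<times> (nat \<Rightarrow> 'a)) set" where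
  "completion_rel N =
     {(X, Y). norm_Cauchy N X \<and> norm_Cauchy N Y \<and> (\<lambda>n. N (X n - Y n)) \<longlonglongrightarrow> 0}"

definition norm_completion :: "('a::ab_group_add \<Rightarrow> real) \<Rightarrow> (nat \<Rightarrow> 'a) set set" where
  "norm_completion N = {X. norm_Cauchy N X} // completion_rel N"

definition completion_norm :: "('a::ab_group_add \<Rightarrow> real) \<Rightarrow> (nat \<Rightarrow> 'a) set \<Rightarrow> real" where
  "completion_norm N \<xi> = (THE r. \<forall>X\<in>\<xi>. (\<lambda>n. N (X n)) \<longlonglongrightarrow> r)"

definition completion_add ::
    "('a::ab_group_add \<Rightarrow> real) \<Rightarrow> (nat \<Rightarrow> 'a) set \<Rightarrow> (nat \<Rightarrow> 'a) set \<Rightarrow> (nat \<Rightarrow> 'a) set" where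
  "completion_add N \<xi> \<eta> = (\<Union>X\<in>\<xi>. \<Union>Y\<in>\<eta>. completion_rel N `` {\<lambda>n. X n + Y n})"

definition completion_scale ::
    "(complex \<Rightarrow> 'a \<Rightarrow> 'a) \<Rightarrow> ('a::ab_group_add \<Rightarrow> real) \<Rightarrow> complex \<Rightarrow> (nat \<Rightarrow> 'a) set
      \<Rightarrow> (nat \<Rightarrow> 'a) set" where
  "completion_scale smul N c \<xi> = (\<Union>X\<in>\<xi>. completion_rel N `` {\<lambda>n. smul c (X n)})"

definition completion_emb :: "('a::ab_group_add \<Rightarrow> real) \<Rightarrow> 'a \<Rightarrow> (nat \<Rightarrow> 'a) set" where
  "completion_emb N x = completion_rel N `` {\<lambda>_. x}"

definition completion_dual ::
    "(complex \<Rightarrow> 'a \<Rightarrow> 'a) \<Rightarrow> ('a::ab_group_add \<Rightarrow> real) \<Rightarrow> ((nat \<Rightarrow> 'a) set \<Rightarrow> complex) set" where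
  "completion_dual smul N =
     {g \<in> extensional (norm_completion N).
        (\<forall>\<xi>\<in>norm_completion N. \<forall>\<eta>\<in>norm_completion N. g (completion_add N \<xi> \<eta>) = g \<xi> + g \<eta>)
      \<and> (\<forall>c. \<forall>\<xi>\<in>norm_completion N. g (completion_scale smul N c \<xi>) = c * g \<xi>)
      \<and> (\<exists>C. \<forall>\<xi>\<in>norm_completion N. cmod (g \<xi>) \<le> C * completion_norm N \<xi>)}"

definition completion_dual_norm ::
    "('a::ab_group_add \<Rightarrow> real) \<Rightarrow> ((nat \<Rightarrow> 'a) set \<Rightarrow> complex) \<Rightarrow> real" where
  "completion_dual_norm N g = (SUP \<xi>\<in>{\<xi>\<in>norm_completion N. completion_norm N \<xi> \<le> 1}. cmod (g \<xi>))"

text \<open>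
  The Banach duals of the different completions become comparable (and the union over all norms
  makes sense) by regarding their elements as functionals on the original space. By density,
  restriction is injective on \<^const>\<open>completion_dual\<close>, and \<open>norm_dual_norm\<close> is the Banach dual norm
  transported along it.
\<close>

definition completion_restrict ::
    "('a::ab_group_add \<Rightarrow> real) \<Rightarrow> ((nat \<Rightarrow> 'a) set \<Rightarrow> complex) \<Rightarrow> 'a \<Rightarrow> complex" where
  "completion_restrict N g = (\<lambda>x. g (completion_emb N x))"

definition norm_dual ::
    "(complex \<Rightarrow> 'a \<Rightarrow> 'a) \<Rightarrow> ('a::ab_group_add \<Rightarrow> real) \<Rightarrow> ('a \<Rightarrow> complex) set" where
  "norm_dual smul N = completion_restrict N ` completion_dual smul N"

definition norm_dual_norm ::
    "(complex \<Rightarrow> 'a \<Rightarrow> 'a) \<Rightarrow> ('a::ab_group_add \<Rightarrow> real) \<Rightarrow> ('a \<Rightarrow> complex) \<Rightarrow> real" where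
  "norm_dual_norm smul N f =
     completion_dual_norm N (the_inv_into (completion_dual smul N) (completion_restrict N) f)"


section \<open>Countably normed spaces and strong algebras\<close>

text \<open>The norms are indexed from \<open>0\<close>.\<close>

locale countably_normed_space = vector_space smul
  for smul :: "complex \<Rightarrow> 'a::ab_group_add \<Rightarrow> 'a" +
  fixes nrm :: "nat \<Rightarrow> 'a \<Rightarrow> real"
  assumes norms: "complex_norm smul (nrm p)"
    and nondecreasing: "p \<le> q \<Longrightarrow> nrm p x \<le> nrm q x"
    and compatible: "norm_Cauchy (nrm p) X \<Longrightarrow> norm_Cauchy (nrm q) X
      \<Longrightarrow> (\<lambda>k. nrm p (X k)) \<longlonglongrightarrow> 0 \<Longrightarrow> (\<lambda>k. nrm q (X k)) \<longlonglongrightarrow> 0"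

definition countably_normed_complete :: "(nat \<Rightarrow> 'a::ab_group_add \<Rightarrow> real) \<Rightarrow> bool" where
  "countably_normed_complete nrm \<longleftrightarrow>
     (\<forall>X. (\<forall>p. norm_Cauchy (nrm p) X) \<longrightarrow> (\<exists>x. \<forall>p. (\<lambda>k. nrm p (X k - x)) \<longlonglongrightarrow> 0))"

definition dual_union ::
    "(complex \<Rightarrow> 'a \<Rightarrow> 'a) \<Rightarrow> (nat \<Rightarrow> 'a::ab_group_add \<Rightarrow> real) \<Rightarrow> ('a \<Rightarrow> complex) set" where
  "dual_union smul nrm = (\<Union>p. norm_dual smul (nrm p))"

definition strong_dual_topology ::
    "(complex \<Rightarrow> 'a \<Rightarrow> 'a) \<Rightarrow> (nat \<Rightarrow> 'a::ab_group_add \<Rightarrow> real) \<Rightarrow> ('a \<Rightarrow> complex) topology" where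
  "strong_dual_topology smul nrm =
     lc_topology (dual_union smul nrm) (strong_seminorms UNIV (range nrm))"

text \<open>Associative algebras, not necessarily commutative or unital.\<close>

definition complex_algebra_on ::
    "(complex \<Rightarrow> 'v \<Rightarrow> 'v) \<Rightarrow> 'v::ab_group_add set \<Rightarrow> ('v \<Rightarrow> 'v \<Rightarrow> 'v) \<Rightarrow> bool" where
  "complex_algebra_on smul A prd \<longleftrightarrow>
     vector_space smul \<and> module.subspace smul A
   \<and> (\<forall>a\<in>A. \<forall>b\<in>A. prd a b \<in> A)
   \<and> (\<forall>a\<in>A. \<forall>b\<in>A. \<forall>c\<in>A. prd (a + b) c = prd a c + prd b c)
   \<and> (\<forall>a\<in>A. \<forall>b\<in>A. \<forall>c\<in>A. prd a (b + c) = prd a b + prd a c)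
   \<and> (\<forall>z. \<forall>a\<in>A. \<forall>b\<in>A. prd (smul z a) b = smul z (prd a b))
   \<and> (\<forall>z. \<forall>a\<in>A. \<forall>b\<in>A. prd a (smul z b) = smul z (prd a b))
   \<and> (\<forall>a\<in>A. \<forall>b\<in>A. \<forall>c\<in>A. prd (prd a b) c = prd a (prd b c))"

definition topological_complex_algebra_on ::
    "(complex \<Rightarrow> 'v \<Rightarrow> 'v) \<Rightarrow> 'v::ab_group_add set \<Rightarrow> 'v topology \<Rightarrow> ('v \<Rightarrow> 'v \<Rightarrow> 'v) \<Rightarrow> bool" where
  "topological_complex_algebra_on smul A T prd \<longleftrightarrow>
     complex_algebra_on smul A prd \<and> topspace T = A
   \<and> continuous_map (prod_topology T T) T (\<lambda>(a, b). a + b)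
   \<and> continuous_map (prod_topology euclidean T) T (\<lambda>(z, a). smul z a)
   \<and> continuous_map (prod_topology T T) T (\<lambda>(a, b). prd a b)"

text \<open>
  That the products in the last assumption lie in the dual for the larger norm is implicit in the
  finiteness of their norms. A natural number \<open>d\<close> is no restriction, since \<open>d\<close> may be enlarged.
\<close>

locale strong_algebra = countably_normed_space smul nrm
  for smul :: "complex \<Rightarrow> 'a::ab_group_add \<Rightarrow> 'a" and nrm :: "nat \<Rightarrow> 'a \<Rightarrow> real" +
  fixes prd :: "('a \<Rightarrow> complex) \<Rightarrow> ('a \<Rightarrow> complex) \<Rightarrow> ('a \<Rightarrow> complex)"
  assumes complete: "countably_normed_complete nrm"
    and reflexive: "lc_reflexive smul UNIV (range nrm)"
    and algebra: "complex_algebra_on fun_scale (dual_union smul nrm) prd"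
    and mult_bound: "\<exists>d::nat. \<forall>q p. p > q + d \<longrightarrow>
      (\<exists>K>0. \<forall>a\<in>norm_dual smul (nrm q). \<forall>b\<in>norm_dual smul (nrm p).
         prd a b \<in> norm_dual smul (nrm p) \<and> prd b a \<in> norm_dual smul (nrm p)
       \<and> norm_dual_norm smul (nrm p) (prd a b)
           \<le> K * norm_dual_norm smul (nrm q) a * norm_dual_norm smul (nrm p) b
       \<and> norm_dual_norm smul (nrm p) (prd b a)
           \<le> K * norm_dual_norm smul (nrm q) a * norm_dual_norm smul (nrm p) b)"


section \<open>Basic facts confirming the definitions\<close>

text \<open>
  Elements of \<^const>\<open>norm_dual\<close> are the functionals on the original space that are bounded for the
  norm, with the usual operator norm; their union is the topological dual; and the strong topology
  has the expected neighbourhoods.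
\<close>

context complex_norm
begin

lemma N_0 [simp]: "N 0 = 0"
  using eq_0_iff by blast

lemma N_uminus: "N (- x) = N x"
  using norm_smul[of "-1" x] by simp

lemma N_nonneg: "0 \<le> N x"
  using triangle[of x "- x"] by (simp add: N_uminus)

lemma N_minus_commute: "N (x - y) = N (y - x)"
  using N_uminus[of "x - y"] by simp

lemma N_diff_triangle: "N (x - z) \<le> N (x - y) + N (y - z)"
  using triangle[of "x - y" "y - z"] by simp

lemma N_diff_le: "\<bar>N x - N y\<bar> \<le> N (x - y)"
  using triangle[of "x - y" y] triangle[of "y - x" x] N_minus_commute[of x y] by simp

lemma Cauchy_const: "norm_Cauchy N (\<lambda>_. x)"
  by (simp add: norm_Cauchy_def)

lemma Cauchy_add:
  assumes "norm_Cauchy N X" "norm_Cauchy N Y"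
  shows "norm_Cauchy N (\<lambda>n. X n + Y n)"
  unfolding norm_Cauchy_def
proof (intro allI impI)
  fix e :: real assume "e > 0"
  then have "e/2 > 0" by simp
  then obtain M1 M2 where M: "\<forall>m\<ge>M1. \<forall>n\<ge>M1. N (X m - X n) < e/2" "\<forall>m\<ge>M2. \<forall>n\<ge>M2. N (Y m - Y n) < e/2"
    using assms unfolding norm_Cauchy_def by blast
  have "N (X m + Y m - (X n + Y n)) < e" if "m \<ge> max M1 M2" "n \<ge> max M1 M2" for m n
  proof -
    have "N (X m - X n) < e/2" "N (Y m - Y n) < e/2" using M that by auto
    moreover have "X m + Y m - (X n + Y n) = (X m - X n) + (Y m - Y n)" by simp
    ultimately show ?thesis using triangle[of "X m - X n" "Y m - Y n"] by (smt (verit) field_sum_of_halves)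
  qed
  then show "\<exists>M. \<forall>m\<ge>M. \<forall>n\<ge>M. N (X m + Y m - (X n + Y n)) < e" by blast
qed

lemma Cauchy_smul:
  assumes "norm_Cauchy N X"
  shows "norm_Cauchy N (\<lambda>n. smul c (X n))"
  unfolding norm_Cauchy_def
proof (intro allI impI)
  fix e :: real assume "e > 0"
  define k where "k = cmod c + 1"
  have k: "k > 0" unfolding k_def by (smt (verit) norm_ge_zero)
  then have "e/k > 0" using \<open>e > 0\<close> by simp
  then obtain M where M: "\<forall>m\<ge>M. \<forall>n\<ge>M. N (X m - X n) < e/k"
    using assms unfolding norm_Cauchy_def by blast
  have "N (smul c (X m) - smul c (X n)) < e" if "m \<ge> M" "n \<ge> M" for m n
  proof -
    have "N (smul c (X m) - smul c (X n)) = cmod c * N (X m - X n)"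
      by (metis norm_smul scale_right_diff_distrib)
    also have "\<dots> \<le> k * N (X m - X n)"
      by (rule mult_right_mono) (simp_all add: k_def N_nonneg)
    also have "\<dots> < e" using M that k by (simp add: pos_less_divide_eq mult.commute)
    finally show ?thesis .
  qed
  then show "\<exists>M. \<forall>m\<ge>M. \<forall>n\<ge>M. N (smul c (X m) - smul c (X n)) < e" by blast
qed

lemma Cauchy_image:
  fixes f :: "'a \<Rightarrow> 'b::real_normed_vector"
  assumes "norm_Cauchy N X" and f: "\<And>x y. norm (f x - f y) \<le> C * N (x - y)"
  shows "Cauchy (\<lambda>n. f (X n))"
proof (rule CauchyI)
  fix e :: real assume "e > 0"
  define k where "k = \<bar>C\<bar> + 1"
  have k: "k > 0" unfolding k_def by simp
  then have "e/k > 0" using \<open>e > 0\<close> by simp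
  then obtain M where M: "\<forall>m\<ge>M. \<forall>n\<ge>M. N (X m - X n) < e/k"
    using assms(1) unfolding norm_Cauchy_def by blast
  have "norm (f (X m) - f (X n)) < e" if "m \<ge> M" "n \<ge> M" for m n
  proof -
    have "norm (f (X m) - f (X n)) \<le> C * N (X m - X n)" by (rule f)
    also have "\<dots> \<le> k * N (X m - X n)"
      by (rule mult_right_mono) (simp_all add: k_def N_nonneg)
    also have "\<dots> < e" using M that k by (simp add: pos_less_divide_eq mult.commute)
    finally show ?thesis .
  qed
  then show "\<exists>M. \<forall>m\<ge>M. \<forall>n\<ge>M. norm (f (X m) - f (X n)) < e" by blast
qed

lemma equiv_completion_rel: "equiv {X. norm_Cauchy N X} (completion_rel N)"
proof (rule equivI)
  show "completion_rel N \<subseteq> {X. norm_Cauchy N X} \<times> {X. norm_Cauchy N X}"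
    by (auto simp: completion_rel_def)
  show "refl_on {X. norm_Cauchy N X} (completion_rel N)"
    by (auto simp: completion_rel_def refl_on_def)
  show "sym (completion_rel N)"
    by (auto simp: completion_rel_def sym_def N_minus_commute)
  show "trans (completion_rel N)"
  proof (rule transI)
    fix X Y Z assume a: "(X, Y) \<in> completion_rel N" "(Y, Z) \<in> completion_rel N"
    then have "(\<lambda>n. N (X n - Y n) + N (Y n - Z n)) \<longlonglongrightarrow> 0"
      using tendsto_add[of "\<lambda>n. N (X n - Y n)" 0 sequentially "\<lambda>n. N (Y n - Z n)" 0]
      by (simp add: completion_rel_def)
    then have "(\<lambda>n. N (X n - Z n)) \<longlonglongrightarrow> 0"
      by (rule tendsto_sandwich[of "\<lambda>_. 0", rotated 3])
         (auto simp: N_nonneg N_diff_triangle)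
    then show "(X, Z) \<in> completion_rel N"
      using a by (simp add: completion_rel_def)
  qed
qed

abbreviation cls :: "(nat \<Rightarrow> 'a) \<Rightarrow> (nat \<Rightarrow> 'a) set" where
  "cls X \<equiv> completion_rel N `` {X}"

lemma cls_in: "norm_Cauchy N X \<Longrightarrow> cls X \<in> norm_completion N"
  unfolding norm_completion_def by (auto intro: quotientI)

lemma completionE:
  assumes "\<xi> \<in> norm_completion N" obtains X where "norm_Cauchy N X" "\<xi> = cls X"
  using assms unfolding norm_completion_def by (auto elim: quotientE)

lemma tendsto_completion_norm:
  assumes X: "norm_Cauchy N X"
  shows "(\<lambda>n. N (X n)) \<longlonglongrightarrow> completion_norm N (cls X)"
proof -
  have "Cauchy (\<lambda>n. N (X n))"
    by (rule Cauchy_image[OF X, of _ 1]) (simp add: N_diff_le)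
  then obtain r where r: "(\<lambda>n. N (X n)) \<longlonglongrightarrow> r"
    using Cauchy_convergent convergent_def by blast
  have r': "(\<lambda>n. N (Y n)) \<longlonglongrightarrow> r" if "Y \<in> cls X" for Y
  proof -
    from that have "(\<lambda>n. N (X n - Y n)) \<longlonglongrightarrow> 0" by (simp add: completion_rel_def)
    then have "(\<lambda>n. N (X n) - N (Y n)) \<longlonglongrightarrow> 0"
      by (rule Lim_null_comparison[rotated]) (simp add: N_diff_le)
    with r show ?thesis using tendsto_diff[OF r] by fastforce
  qed
  have "X \<in> cls X" using X by (simp add: completion_rel_def)
  then have "completion_norm N (cls X) = r"
    unfolding completion_norm_def
    by (intro the_equality) (use r r' LIMSEQ_unique in blast)+
  with r show ?thesis by simp
qed

lemma cls_eqI: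
  assumes "norm_Cauchy N X" "norm_Cauchy N Y" "(\<lambda>n. N (X n - Y n)) \<longlonglongrightarrow> 0"
  shows "cls X = cls Y"
  by (rule equiv_class_eq[OF equiv_completion_rel]) (use assms in \<open>simp add: completion_rel_def\<close>)

lemma completion_add_cls:
  assumes X: "norm_Cauchy N X" and Y: "norm_Cauchy N Y"
  shows "completion_add N (cls X) (cls Y) = cls (\<lambda>n. X n + Y n)"
proof -
  have "cls (\<lambda>n. X' n + Y' n) = cls (\<lambda>n. X n + Y n)" if "X' \<in> cls X" "Y' \<in> cls Y" for X' Y'
  proof (rule cls_eqI)
    show "norm_Cauchy N (\<lambda>n. X' n + Y' n)" "norm_Cauchy N (\<lambda>n. X n + Y n)"
      using that X Y by (auto simp: completion_rel_def intro: Cauchy_add)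
    have "(\<lambda>n. N (X n - X' n) + N (Y n - Y' n)) \<longlonglongrightarrow> 0"
      using that tendsto_add[of "\<lambda>n. N (X n - X' n)" 0 sequentially "\<lambda>n. N (Y n - Y' n)" 0]
      by (simp add: completion_rel_def)
    moreover have "N (X' n + Y' n - (X n + Y n)) \<le> N (X n - X' n) + N (Y n - Y' n)" for n
    proof -
      have "X n + Y n - (X' n + Y' n) = (X n - X' n) + (Y n - Y' n)" by simp
      then show ?thesis using triangle N_minus_commute by metis
    qed
    ultimately show "(\<lambda>n. N (X' n + Y' n - (X n + Y n))) \<longlonglongrightarrow> 0"
      by - (rule Lim_null_comparison[rotated], assumption, simp add: N_nonneg)
  qed
  moreover have "X \<in> cls X" "Y \<in> cls Y" using X Y by (auto simp: completion_rel_def)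
  ultimately show ?thesis unfolding completion_add_def by (intro equalityI subsetI) blast+
qed

lemma completion_scale_cls:
  assumes X: "norm_Cauchy N X"
  shows "completion_scale smul N c (cls X) = cls (\<lambda>n. smul c (X n))"
proof -
  have "cls (\<lambda>n. smul c (X' n)) = cls (\<lambda>n. smul c (X n))" if "X' \<in> cls X" for X'
  proof (rule cls_eqI)
    show "norm_Cauchy N (\<lambda>n. smul c (X' n))" "norm_Cauchy N (\<lambda>n. smul c (X n))"
      using that X by (auto simp: completion_rel_def intro: Cauchy_smul)
    have "(\<lambda>n. cmod c * N (X n - X' n)) \<longlonglongrightarrow> 0"
      using that by (auto simp: completion_rel_def intro: tendsto_mult_right_zero)
    moreover have "N (smul c (X' n) - smul c (X n)) = cmod c * N (X n - X' n)" for n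
      by (metis N_minus_commute norm_smul scale_right_diff_distrib)
    ultimately show "(\<lambda>n. N (smul c (X' n) - smul c (X n))) \<longlonglongrightarrow> 0" by simp
  qed
  moreover have "X \<in> cls X" using X by (auto simp: completion_rel_def)
  ultimately show ?thesis unfolding completion_scale_def by (intro equalityI subsetI) blast+
qed

lemma completion_norm_emb: "completion_norm N (completion_emb N x) = N x"
  using tendsto_completion_norm[OF Cauchy_const[of x]] unfolding completion_emb_def
  by (simp add: LIMSEQ_const_iff)

lemma completion_norm_nonneg: "\<xi> \<in> norm_completion N \<Longrightarrow> 0 \<le> completion_norm N \<xi>"
  by (metis completionE tendsto_completion_norm LIMSEQ_le_const N_nonneg)

lemma completion_dual_bound:
  assumes g: "g \<in> completion_dual smul N" 
  obtains C where "C \<ge> 0" "\<And>\<xi>. \<xi> \<in> norm_completion N \<Longrightarrow> cmod (g \<xi>) \<le> C * completion_norm N \<xi>"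
proof -
  from g obtain C where C: "\<forall>\<xi>\<in>norm_completion N. cmod (g \<xi>) \<le> C * completion_norm N \<xi>"
    by (auto simp: completion_dual_def)
  have "cmod (g \<xi>) \<le> \<bar>C\<bar> * completion_norm N \<xi>" if "\<xi> \<in> norm_completion N" for \<xi>
    using that C completion_norm_nonneg[OF that]
    by (meson abs_ge_self mult_right_mono order_trans)
  then show thesis by (intro that[of "\<bar>C\<bar>"]) auto
qed

lemma completion_dual_linear:
  assumes g: "g \<in> completion_dual smul N" and X: "norm_Cauchy N X" "norm_Cauchy N Y"
  shows "g (cls (\<lambda>n. X n + Y n)) = g (cls X) + g (cls Y)"
    "g (cls (\<lambda>n. smul c (X n))) = c * g (cls X)"
proof -
  have "g (completion_add N (cls X) (cls Y)) = g (cls X) + g (cls Y)"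
    "g (completion_scale smul N c (cls X)) = c * g (cls X)"
    using g cls_in[OF X(1)] cls_in[OF X(2)] unfolding completion_dual_def by blast+
  then show "g (cls (\<lambda>n. X n + Y n)) = g (cls X) + g (cls Y)"
    "g (cls (\<lambda>n. smul c (X n))) = c * g (cls X)"
    by (simp_all only: completion_add_cls[OF X] completion_scale_cls[OF X(1)])
qed

lemma tendsto_completion_dual:
  assumes g: "g \<in> completion_dual smul N" and X: "norm_Cauchy N X"
  shows "(\<lambda>n. g (completion_emb N (X n))) \<longlonglongrightarrow> g (cls X)"
proof -
  obtain C where C: "C \<ge> 0" "\<And>\<xi>. \<xi> \<in> norm_completion N \<Longrightarrow> cmod (g \<xi>) \<le> C * completion_norm N \<xi>"
    using completion_dual_bound[OF g] by blast
  have diff: "norm_Cauchy N (\<lambda>n. X n + smul (-1) (X m))" for m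
    using Cauchy_add[OF X Cauchy_const] .
  have geq: "g (cls (\<lambda>n. X n + smul (-1) (X m))) = g (cls X) - g (completion_emb N (X m))" for m
    using completion_dual_linear[OF g X Cauchy_const] completion_dual_linear(2)[OF g Cauchy_const Cauchy_const]
    by (simp add: completion_emb_def del: scale_minus_left)
  show ?thesis
  proof (rule LIMSEQ_I)
    fix e :: real assume "e > 0"
    then have "e / (2 * (C + 1)) > 0" using C(1) by simp
    then obtain M where M: "\<forall>m\<ge>M. \<forall>n\<ge>M. N (X m - X n) < e / (2 * (C + 1))"
      using X unfolding norm_Cauchy_def by blast
    have "cmod (g (completion_emb N (X m)) - g (cls X)) < e" if m: "m \<ge> M" for m
    proof -
      have "completion_norm N (cls (\<lambda>n. X n + smul (-1) (X m))) \<le> e / (2 * (C + 1))"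
        using tendsto_completion_norm[OF diff[of m]]
        by (rule LIMSEQ_le_const2) (use M m in \<open>auto intro!: exI[of _ M] less_imp_le\<close>)
      then have "C * completion_norm N (cls (\<lambda>n. X n + smul (-1) (X m))) \<le> C * (e / (2 * (C + 1)))"
        using C(1) by (rule mult_left_mono)
      also have "\<dots> < e" using C(1) \<open>e > 0\<close>
        by (simp add: field_simps) (smt (verit) mult_nonneg_nonneg)
      finally show ?thesis
        using C(2)[OF cls_in[OF diff[of m]]] unfolding geq by (simp add: norm_minus_commute)
    qed
    then show "\<exists>no. \<forall>n\<ge>no. cmod (g (completion_emb N (X n)) - g (cls X)) < e" by blast
  qed
qed

lemma inj_completion_restrict: "inj_on (completion_restrict N) (completion_dual smul N)"
proof (rule inj_onI)
  fix g h assume g: "g \<in> completion_dual smul N" and h: "h \<in> completion_dual smul N"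
    and eq: "completion_restrict N g = completion_restrict N h"
  have "g \<xi> = h \<xi>" if "\<xi> \<in> norm_completion N" for \<xi>
  proof -
    obtain X where X: "norm_Cauchy N X" "\<xi> = cls X" using \<open>\<xi> \<in> norm_completion N\<close> by (rule completionE)
    have "(\<lambda>n. g (completion_emb N (X n))) = (\<lambda>n. h (completion_emb N (X n)))"
      using eq by (simp add: completion_restrict_def fun_eq_iff)
    then show ?thesis
      using tendsto_completion_dual[OF g X(1)] tendsto_completion_dual[OF h X(1)] X(2)
      by (simp add: LIMSEQ_unique)
  qed
  then show "g = h"
    using g h by (intro extensionalityI[of _ "norm_completion N"]) (auto simp: completion_dual_def)
qed

lemma norm_dual_iff:
  "f \<in> norm_dual smul N \<longleftrightarrow> linear_functional_on smul UNIV f \<and> (\<exists>C. \<forall>x. cmod (f x) \<le> C * N x)"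
proof
  assume "f \<in> norm_dual smul N"
  then obtain g where g: "g \<in> completion_dual smul N" and f: "f = completion_restrict N g"
    unfolding norm_dual_def by auto
  obtain C where C: "C \<ge> 0" "\<And>\<xi>. \<xi> \<in> norm_completion N \<Longrightarrow> cmod (g \<xi>) \<le> C * completion_norm N \<xi>"
    using completion_dual_bound[OF g] by blast
  have "cmod (f x) \<le> C * N x" for x
    using C(2)[OF cls_in[OF Cauchy_const[of x]]] completion_norm_emb[of x]
    by (simp add: f completion_restrict_def completion_emb_def)
  moreover have "linear_functional_on smul UNIV f"
    using completion_dual_linear[OF g Cauchy_const Cauchy_const]
    by (simp add: linear_functional_on_def f completion_restrict_def completion_emb_def)
  ultimately show "linear_functional_on smul UNIV f \<and> (\<exists>C. \<forall>x. cmod (f x) \<le> C * N x)" by blast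
next
  assume "linear_functional_on smul UNIV f \<and> (\<exists>C. \<forall>x. cmod (f x) \<le> C * N x)"
  then obtain C where C: "\<And>x. cmod (f x) \<le> C * N x"
    and add: "\<And>x y. f (x + y) = f x + f y" and sm: "\<And>c x. f (smul c x) = c * f x"
    by (auto simp: linear_functional_on_def)
  have diff: "f (x - y) = f x - f y" for x y using add[of "x - y" y] by simp
  define g where "g = (\<lambda>\<xi>\<in>norm_completion N. lim (\<lambda>n. f ((SOME X. X \<in> \<xi>) n)))"
  have g: "(\<lambda>n. f (X n)) \<longlonglongrightarrow> g (cls X)" if X: "norm_Cauchy N X" for X
  proof -
    define Y where "Y = (SOME Y. Y \<in> cls X)"
    have "X \<in> cls X" using X by (simp add: completion_rel_def)
    then have Y: "Y \<in> cls X" unfolding Y_def by (rule someI[where P = "\<lambda>Y. Y \<in> cls X"])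
    then have "norm_Cauchy N Y" and XY: "(\<lambda>n. N (X n - Y n)) \<longlonglongrightarrow> 0"
      by (auto simp: completion_rel_def)
    from this(1) have "Cauchy (\<lambda>n. f (Y n))"
      by (rule Cauchy_image) (simp flip: diff, rule C)
    then have "(\<lambda>n. f (Y n)) \<longlonglongrightarrow> lim (\<lambda>n. f (Y n))"
      using Cauchy_convergent convergent_LIMSEQ_iff by blast
    moreover have "g (cls X) = lim (\<lambda>n. f (Y n))"
      using cls_in[OF X] by (simp add: g_def Y_def)
    moreover have "(\<lambda>n. f (X n) - f (Y n)) \<longlonglongrightarrow> 0"
      by (rule Lim_null_comparison[of _ "\<lambda>n. C * N (X n - Y n)"])
         (use XY in \<open>auto simp: C simp flip: diff intro: tendsto_mult_right_zero\<close>)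
    ultimately show ?thesis using tendsto_add by fastforce
  qed
  have "g \<in> completion_dual smul N"
    unfolding completion_dual_def
  proof (intro CollectI conjI ballI allI exI[of _ C])
    show "g \<in> extensional (norm_completion N)" by (simp add: g_def)
  next
    fix \<xi> \<eta> assume "\<xi> \<in> norm_completion N" "\<eta> \<in> norm_completion N"
    then obtain X Y where X: "norm_Cauchy N X" "\<xi> = cls X" and Y: "norm_Cauchy N Y" "\<eta> = cls Y"
      by (metis completionE)
    show "g (completion_add N \<xi> \<eta>) = g \<xi> + g \<eta>"
      using g[OF Cauchy_add[OF X(1) Y(1)]] tendsto_add[OF g[OF X(1)] g[OF Y(1)]]
      by (simp add: add X(2) Y(2) completion_add_cls[OF X(1) Y(1)] LIMSEQ_unique)
  next
    fix c \<xi> assume "\<xi> \<in> norm_completion N"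
    then obtain X where X: "norm_Cauchy N X" "\<xi> = cls X" by (rule completionE)
    show "g (completion_scale smul N c \<xi>) = c * g \<xi>"
      using g[OF Cauchy_smul[OF X(1), of c]] tendsto_mult_left[OF g[OF X(1)], of c]
      by (simp add: sm X(2) completion_scale_cls[OF X(1)] LIMSEQ_unique)
  next
    fix \<xi> assume "\<xi> \<in> norm_completion N"
    then obtain X where X: "norm_Cauchy N X" "\<xi> = cls X" by (rule completionE)
    show "cmod (g \<xi>) \<le> C * completion_norm N \<xi>" unfolding X(2)
      by (rule LIMSEQ_le[OF tendsto_norm[OF g[OF X(1)]]
            tendsto_mult_left[OF tendsto_completion_norm[OF X(1)]]]) (simp add: C)
  qed
  moreover have "completion_restrict N g = f"
    using g[OF Cauchy_const] 
    by (auto simp: completion_restrict_def completion_emb_def LIMSEQ_const_iff fun_eq_iff)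
  ultimately show "f \<in> norm_dual smul N" unfolding norm_dual_def by blast
qed

lemma norm_dual_norm_eq:
  assumes f: "f \<in> norm_dual smul N"
  shows "norm_dual_norm smul N f = (SUP x\<in>{x. N x \<le> 1}. cmod (f x))"
proof -
  obtain g where g: "g \<in> completion_dual smul N" and fg: "f = completion_restrict N g"
    using f unfolding norm_dual_def by auto
  have eq: "norm_dual_norm smul N f = completion_dual_norm N g"
    unfolding norm_dual_norm_def fg using the_inv_into_f_f[OF inj_completion_restrict g] by simp
  obtain C where C: "C \<ge> 0" "\<And>\<xi>. \<xi> \<in> norm_completion N \<Longrightarrow> cmod (g \<xi>) \<le> C * completion_norm N \<xi>"
    using completion_dual_bound[OF g] by blast
  let ?B = "{\<xi>\<in>norm_completion N. completion_norm N \<xi> \<le> 1}"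
  define M where "M = (SUP x\<in>{x. N x \<le> 1}. cmod (f x))"
  have C1: "cmod (g \<xi>) \<le> C" if "\<xi> \<in> ?B" for \<xi>
    using C(2)[of \<xi>] that C(1) mult_left_le[of "completion_norm N \<xi>" C] by auto
  have bdd: "bdd_above ((\<lambda>\<xi>. cmod (g \<xi>)) ` ?B)" using C1 by (intro bdd_aboveI2)
  have emb: "completion_emb N x \<in> norm_completion N" for x
    unfolding completion_emb_def by (rule cls_in[OF Cauchy_const])
  then have embB: "completion_emb N x \<in> ?B" if "N x \<le> 1" for x
    using that by (simp add: completion_norm_emb)
  have fx: "f x = g (completion_emb N x)" for x by (simp add: fg completion_restrict_def)
  have bdd': "bdd_above ((\<lambda>x. cmod (f x)) ` {x. N x \<le> 1})"
    using C1[OF embB] by (intro bdd_aboveI2[of _ _ C]) (simp add: fx)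
  have lin: "linear_functional_on smul UNIV f" using f norm_dual_iff by blast
  have M0: "0 \<le> M"
    unfolding M_def by (rule cSUP_upper2[OF bdd', of 0]) simp_all
  have bound: "cmod (f x) \<le> M * N x" for x
  proof (cases "x = 0")
    case True
    have "f 0 = 0" using lin unfolding linear_functional_on_def by (metis UNIV_I add_cancel_right_right)
    then show ?thesis using True by simp
  next
    case False
    then have pos: "N x > 0" using N_nonneg[of x] eq_0_iff[of x] by linarith
    let ?c = "complex_of_real (1 / N x)"
    have "N (smul ?c x) \<le> 1" using pos by (simp add: norm_smul norm_divide)
    then have "cmod (f (smul ?c x)) \<le> M" unfolding M_def by (intro cSUP_upper[OF _ bdd']) simp
    moreover have "f (smul ?c x) = ?c * f x" using lin unfolding linear_functional_on_def by blast
    ultimately have "cmod (?c * f x) \<le> M" by metis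
    then have "1 / N x * cmod (f x) \<le> M"
      unfolding norm_mult norm_of_real using pos by simp
    then show ?thesis using pos by (simp add: field_simps)
  qed
  have "completion_dual_norm N g \<le> M"
    unfolding completion_dual_norm_def
  proof (rule cSUP_least)
    show "?B \<noteq> {}" using embB[of 0] by auto
    fix \<xi> assume xi: "\<xi> \<in> ?B"
    then obtain X where X: "norm_Cauchy N X" "\<xi> = cls X" by (auto elim: completionE)
    have "cmod (g \<xi>) \<le> M * completion_norm N \<xi>" unfolding X(2)
      by (rule LIMSEQ_le[OF tendsto_norm[OF tendsto_completion_dual[OF g X(1)]]
            tendsto_mult_left[OF tendsto_completion_norm[OF X(1)]]])
         (simp add: bound flip: fx)
    also have "\<dots> \<le> M" using xi M0 by (simp add: mult_left_le)
    finally show "cmod (g \<xi>) \<le> M" .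
  qed
  moreover have "M \<le> completion_dual_norm N g"
    unfolding M_def completion_dual_norm_def
  proof (rule cSUP_mono[OF _ bdd])
    show "{x. N x \<le> 1} \<noteq> {}" by (auto intro!: exI[of _ 0])
    show "\<exists>\<xi>\<in>?B. cmod (f x) \<le> cmod (g \<xi>)" if "x \<in> {x. N x \<le> 1}" for x
      using embB[of x] that by (intro bexI[of _ "completion_emb N x"]) (simp_all add: fx)
  qed
  ultimately show ?thesis using eq M_def by simp
qed

end

lemma openin_lc_topology:
  assumes S: "\<And>x y z p. \<lbrakk>x \<in> S; y \<in> S; z \<in> S; p \<in> P\<rbrakk> \<Longrightarrow> p (x - z) \<le> p (x - y) + p (y - z)"
    and p0: "\<And>p. p \<in> P \<Longrightarrow> p 0 = 0"
    and dir: "\<And>p q. \<lbrakk>p \<in> P; q \<in> P\<rbrakk> \<Longrightarrow> \<exists>r\<in>P. \<forall>x\<in>S. \<forall>y\<in>S. p (x - y) \<le> r (x - y) \<and> q (x - y) \<le> r (x - y)"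
    and ne: "P \<noteq> {}"
  shows "openin (lc_topology S P) U \<longleftrightarrow>
    U \<subseteq> S \<and> (\<forall>x\<in>U. \<exists>p\<in>P. \<exists>e>0. {y\<in>S. p (y - x) < e} \<subseteq> U)" (is "_ \<longleftrightarrow> ?R U")
proof
  assume "openin (lc_topology S P) U"
  then have "generate_topology_on {{y \<in> S. p (y - x) < e} | x p e. x \<in> S \<and> p \<in> P \<and> 0 < e} U"
    unfolding lc_topology_def by (rule openin_topology_generated_by)
  then show "?R U"
  proof induction
    case Empty then show ?case by simp
  next
    case (Int a b)
    have "\<exists>p\<in>P. \<exists>e>0. {y\<in>S. p (y - x) < e} \<subseteq> a \<inter> b" if x: "x \<in> a \<inter> b" for x
    proof -
      obtain p d where p: "p\<in>P" "d>0" "{y\<in>S. p (y - x) < d} \<subseteq> a" using Int x by blast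
      obtain q e where q: "q\<in>P" "e>0" "{y\<in>S. q (y - x) < e} \<subseteq> b" using Int x by blast
      obtain r where r: "r\<in>P" "\<forall>x\<in>S. \<forall>y\<in>S. p (x - y) \<le> r (x - y) \<and> q (x - y) \<le> r (x - y)"
        using dir[OF p(1) q(1)] by blast
      have "x \<in> S" using Int x by blast
      then have "p (y - x) \<le> r (y - x)" "q (y - x) \<le> r (y - x)" if "y \<in> S" for y
        using r(2) that by auto
      then have "{y\<in>S. r (y - x) < min d e} \<subseteq> {y\<in>S. p (y - x) < d} \<inter> {y\<in>S. q (y - x) < e}"
        by force
      then have "{y\<in>S. r (y - x) < min d e} \<subseteq> a \<inter> b"
        using p(3) q(3) by blast
      then show ?thesis using r(1) p(2) q(2) by (intro bexI[of _ r] exI[of _ "min d e"]) auto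
    qed
    then show ?case using Int by blast
  next
    case (UN K)
    have "\<exists>p\<in>P. \<exists>e>0. {y\<in>S. p (y - x) < e} \<subseteq> \<Union>K" if "x \<in> k" "k \<in> K" for x k
      using UN.IH[OF that(2)] that by (meson Union_upper order_trans)
    then show ?case using UN.IH by blast
  next
    case (Basis s)
    then obtain x p e where s: "s = {y \<in> S. p (y - x) < e}" "x \<in> S" "p \<in> P" "e > 0" by blast
    have "{z\<in>S. p (z - y) < e - p (y - x)} \<subseteq> s" if "y \<in> s" for y
      using that s S[of _ y x p] by fastforce
    moreover have "e - p (y - x) > 0" if "y \<in> s" for y using that s by simp
    ultimately show ?case using s by blast
  qed
next
  assume R: "?R U"
  let ?G = "{V. V \<subseteq> U \<and> (\<exists>x p e. V = {y \<in> S. p (y - x) < e} \<and> x \<in> S \<and> p \<in> P \<and> 0 < e)}"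
  have "U = \<Union>?G"
  proof
    show "U \<subseteq> \<Union>?G"
    proof
      fix x assume "x \<in> U"
      then obtain p e where "p\<in>P" "e>0" "{y\<in>S. p (y - x) < e} \<subseteq> U" "x \<in> S" using R by blast
      then show "x \<in> \<Union>?G"
        using p0[of p] by (intro UnionI[of "{y\<in>S. p (y - x) < e}"]) auto
    qed
  qed auto
  moreover have "openin (lc_topology S P) (\<Union>?G)"
    unfolding lc_topology_def
    by (intro openin_Union topology_generated_by_Basis) blast
  ultimately show "openin (lc_topology S P) U" by simp
qed

lemma topspace_lc_topology:
  assumes "\<And>p. p \<in> P \<Longrightarrow> p 0 = 0" "P \<noteq> {}"
  shows "topspace (lc_topology S P) = S"
proof -
  have "x \<in> {y \<in> S. p (y - x) < 1}" if "x \<in> S" "p \<in> P" for x p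
    using that assms(1)[of p] by simp
  then show ?thesis unfolding lc_topology_def topology_generated_by_topspace
    using assms(2) zero_less_one by blast
qed

context countably_normed_space
begin

lemma openin_norms:
  "openin (lc_topology UNIV (range nrm)) U \<longleftrightarrow> (\<forall>x\<in>U. \<exists>p. \<exists>e>0. {y. nrm p (y - x) < e} \<subseteq> U)"
proof (subst openin_lc_topology)
  interpret complex_norm smul "nrm p" for p by (rule norms)
  show "p (x - z) \<le> p (x - y) + p (y - z)" if "p \<in> range nrm" for p x y z
    using that N_diff_triangle by auto
  show "p 0 = 0" if "p \<in> range nrm" for p
    using that by auto
  show "\<exists>r\<in>range nrm. \<forall>x\<in>UNIV. \<forall>y\<in>UNIV. p (x - y) \<le> r (x - y) \<and> q (x - y) \<le> r (x - y)"
    if "p \<in> range nrm" "q \<in> range nrm" for p q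
  proof -
    from that obtain m n where "p = nrm m" "q = nrm n" by blast
    then show ?thesis
      by (intro bexI[of _ "nrm (max m n)"]) (auto intro: nondecreasing)
  qed
qed auto

lemma continuous_dual_eq_dual_union:
  "continuous_dual smul UNIV (range nrm) = dual_union smul nrm"
proof -
  interpret complex_norm smul "nrm p" for p by (rule norms)
  have top: "topspace (lc_topology UNIV (range nrm)) = UNIV"
    by (rule topspace_lc_topology) auto
  have "continuous_map (lc_topology UNIV (range nrm)) euclidean f \<longleftrightarrow> (\<exists>p C. \<forall>x. cmod (f x) \<le> C * nrm p x)"
    if lin: "linear_functional_on smul UNIV f" for f
  proof
    have f0: "f 0 = 0" using lin unfolding linear_functional_on_def by (metis UNIV_I add_cancel_right_right)
    assume "continuous_map (lc_topology UNIV (range nrm)) euclidean f"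
    then have "openin (lc_topology UNIV (range nrm)) {x. f x \<in> ball 0 1}"
      using openin_continuous_map_preimage[of "lc_topology UNIV (range nrm)" euclidean f "ball 0 1"] top
      by (simp flip: open_openin)
    then obtain p e where e: "e > 0" "{y. nrm p (y - 0) < e} \<subseteq> {x. f x \<in> ball 0 1}"
      unfolding openin_norms using f0 by (metis mem_Collect_eq centre_in_ball zero_less_one)
    have "cmod (f x) \<le> (2/e) * nrm p x" for x
    proof (cases "x = 0")
      case False
      then have pos: "nrm p x > 0" using N_nonneg[of p x] eq_0_iff[of p x] by linarith
      let ?c = "complex_of_real (e / (2 * nrm p x))"
      have "nrm p (smul ?c x) < e" using pos e(1) by (simp add: norm_smul norm_divide norm_mult)
      then have "cmod (f (smul ?c x)) < 1" using e(2) by auto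
      moreover have "f (smul ?c x) = ?c * f x" using lin unfolding linear_functional_on_def by blast
      ultimately have "cmod (?c * f x) < 1" by metis
      then have "e / (2 * nrm p x) * cmod (f x) < 1"
        unfolding norm_mult norm_of_real using pos e(1) by simp
      then show ?thesis using pos e(1) by (simp add: field_simps)
    qed (simp add: f0)
    then show "\<exists>p C. \<forall>x. cmod (f x) \<le> C * nrm p x" by blast
  next
    assume "\<exists>p C. \<forall>x. cmod (f x) \<le> C * nrm p x"
    then obtain p C where C: "\<And>x. cmod (f x) \<le> C * nrm p x" by blast
    have diff: "f (x - y) = f x - f y" for x y
      using lin unfolding linear_functional_on_def by (metis UNIV_I add_diff_cancel diff_add_cancel)
    have "openin (lc_topology UNIV (range nrm)) {x. f x \<in> V}" if V: "open V" for V
      unfolding openin_norms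
    proof
      fix x assume "x \<in> {x. f x \<in> V}"
      then obtain e where e: "e > 0" "ball (f x) e \<subseteq> V" using V by (auto elim: openE)
      have "f y \<in> V" if y: "nrm p (y - x) < e / (\<bar>C\<bar> + 1)" for y
      proof -
        have "cmod (f y - f x) \<le> C * nrm p (y - x)" using C diff by metis
        also have "\<dots> \<le> (\<bar>C\<bar> + 1) * nrm p (y - x)"
          by (rule mult_right_mono) (auto simp: N_nonneg)
        also have "\<dots> < e" using y by (simp add: pos_less_divide_eq mult.commute)
        finally show ?thesis using e(2) by (auto simp: dist_norm norm_minus_commute)
      qed
      moreover have "e / (\<bar>C\<bar> + 1) > 0" using e(1) by simp
      ultimately show "\<exists>p. \<exists>e>0. {y. nrm p (y - x) < e} \<subseteq> {x. f x \<in> V}" by blast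
    qed
    then show "continuous_map (lc_topology UNIV (range nrm)) euclidean f"
      by (simp add: continuous_map top open_openin[symmetric])
  qed
  then show ?thesis
    unfolding continuous_dual_def dual_union_def norm_dual_iff extensional_UNIV set_eq_iff
      mem_Collect_eq UN_iff by (simp add: norm_dual_iff) blast
qed

lemma bdd_above_dual_union:
  assumes f: "f \<in> dual_union smul nrm" and B: "lc_bounded UNIV (range nrm) B"
  shows "bdd_above ((\<lambda>x. cmod (f x)) ` B)"
proof -
  interpret complex_norm smul "nrm p" for p by (rule norms)
  obtain p C where C: "\<And>x. cmod (f x) \<le> C * nrm p x"
    using f by (auto simp: dual_union_def norm_dual_iff)
  obtain K where K: "\<And>x. x \<in> B \<Longrightarrow> nrm p x \<le> K"
    using B by (simp add: lc_bounded_def bdd_above_def) blast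
  have "cmod (f x) \<le> \<bar>C\<bar> * K" if "x \<in> B" for x
    using C[of x] mult_mono[of C "\<bar>C\<bar>" "nrm p x" K] K[OF that] N_nonneg[of p x] by linarith
  then show ?thesis by (rule bdd_aboveI2)
qed

lemma openin_strong_dual_topology:
  "openin (strong_dual_topology smul nrm) U \<longleftrightarrow>
     U \<subseteq> dual_union smul nrm \<and>
     (\<forall>a\<in>U. \<exists>B. lc_bounded UNIV (range nrm) B \<and> B \<noteq> {} \<and>
        (\<exists>e>0. {b \<in> dual_union smul nrm. (SUP x\<in>B. cmod (b x - a x)) < e} \<subseteq> U))"
proof -
  let ?A = "dual_union smul nrm" and ?bd = "lc_bounded UNIV (range nrm)"
  have bdd: "bdd_above ((\<lambda>x. cmod (f x - g x)) ` B)" if fgB: "f \<in> ?A" "g \<in> ?A" "?bd B" for f g B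
  proof -
    obtain K L where "\<And>x. x \<in> B \<Longrightarrow> cmod (f x) \<le> K" "\<And>x. x \<in> B \<Longrightarrow> cmod (g x) \<le> L"
      using bdd_above_dual_union[OF fgB(1,3)] bdd_above_dual_union[OF fgB(2,3)]
      by (simp add: bdd_above_def) blast
    then show ?thesis
      by (intro bdd_aboveI2[of _ _ "K + L"] order_trans[OF norm_triangle_ineq4] add_mono)
  qed
  have sub: "(SUP x\<in>B. cmod (f x - g x)) \<le> (SUP x\<in>C. cmod (f x - g x))"
    if "f \<in> ?A" "g \<in> ?A" "?bd C" "B \<subseteq> C" "B \<noteq> {}" for f g B C
    using that by (intro cSUP_subset_mono bdd) auto
  have "openin (strong_dual_topology smul nrm) U \<longleftrightarrow> U \<subseteq> ?A \<and>
     (\<forall>a\<in>U. \<exists>p\<in>strong_seminorms UNIV (range nrm). \<exists>e>0. {b \<in> ?A. p (b - a) < e} \<subseteq> U)"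
    unfolding strong_dual_topology_def
  proof (rule openin_lc_topology)
    fix f g h p assume fgh: "f \<in> ?A" "g \<in> ?A" "h \<in> ?A" and "p \<in> strong_seminorms UNIV (range nrm)"
    then obtain B where p: "p = (\<lambda>f. SUP x\<in>B. cmod (f x))" and B: "?bd B" "B \<noteq> {}"
      by (auto simp: strong_seminorms_def)
    have "cmod (f x - h x) \<le> (SUP x\<in>B. cmod (f x - g x)) + (SUP x\<in>B. cmod (g x - h x))"
      if x: "x \<in> B" for x
      using norm_diff_triangle_ineq[of "f x" "- g x" "h x" "- g x"]
        norm_triangle_ineq[of "f x - g x" "g x - h x"]
        cSUP_upper[OF x bdd[OF fgh(1,2) B(1)]] cSUP_upper[OF x bdd[OF fgh(2,3) B(1)]] by simp
    then show "p (f - h) \<le> p (f - g) + p (g - h)"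
      unfolding p by (auto intro!: cSUP_least B)
  next
    show "p 0 = 0" if "p \<in> strong_seminorms UNIV (range nrm)" for p
    proof -
      from that obtain B where "p = (\<lambda>f. SUP x\<in>B. cmod (f x))" "B \<noteq> {}"
        unfolding strong_seminorms_def by blast
      then show ?thesis by simp
    qed
  next
    fix p q assume "p \<in> strong_seminorms UNIV (range nrm)" "q \<in> strong_seminorms UNIV (range nrm)"
    then obtain B C where p: "p = (\<lambda>f. SUP x\<in>B. cmod (f x))" and B: "?bd B" "B \<noteq> {}"
      and q: "q = (\<lambda>f. SUP x\<in>C. cmod (f x))" and C: "?bd C" "C \<noteq> {}"
      by (auto simp: strong_seminorms_def)
    have BC: "?bd (B \<union> C)" using B C by (auto simp: lc_bounded_def image_Un)
    show "\<exists>r\<in>strong_seminorms UNIV (range nrm). \<forall>f\<in>?A. \<forall>g\<in>?A. p (f - g) \<le> r (f - g) \<and> q (f - g) \<le> r (f - g)"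
    proof (intro bexI[of _ "\<lambda>f. SUP x\<in>B \<union> C. cmod (f x)"] ballI conjI)
      show "(\<lambda>f. SUP x\<in>B \<union> C. cmod (f x)) \<in> strong_seminorms UNIV (range nrm)"
        using BC B(2) unfolding strong_seminorms_def by blast
      fix f g assume "f \<in> ?A" "g \<in> ?A"
      then show "p (f - g) \<le> (SUP x\<in>B \<union> C. cmod ((f - g) x))"
          "q (f - g) \<le> (SUP x\<in>B \<union> C. cmod ((f - g) x))"
        unfolding p q using BC B(2) C(2) by (auto intro!: sub)
    qed
  next
    have "?bd {0}" by (auto simp: lc_bounded_def)
    then show "strong_seminorms UNIV (range nrm) \<noteq> {}" unfolding strong_seminorms_def by blast
  qed
  moreover have "(\<exists>p\<in>strong_seminorms UNIV (range nrm). Q p) \<longleftrightarrow>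
      (\<exists>B. ?bd B \<and> B \<noteq> {} \<and> Q (\<lambda>f. SUP x\<in>B. cmod (f x)))" for Q
    unfolding strong_seminorms_def by blast
  ultimately show ?thesis by simp
qed

end
(*END*)

end

theory Submission
  imports Defs
begin

text \<open>
  The strong-algebra inequalities make every product of two dual unit balls bounded in some Banach
  dual, so positive radii \<open>c p\<close> can be chosen such that products of elements of
  the algebraic sum \<open>V\<close> of the balls of radius \<open>c p\<close> lie in a given strong zero neighbourhood.
  It remains to see that \<open>V\<close> is itself a strong zero neighbourhood: it contains
  every functional that is smaller than \<open>1\<close> in modulus on the bounded set
  \<open>C = {x. \<forall>p. c p * \<parallel>x\<parallel>\<^sub>p \<le> 1}\<close>. If a functional \<open>f\<close> is not in \<open>V\<close>, then by Hahn--Banach it is not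
  dominated by any of the finite sums \<open>\<Sum>p\<le>n. c p * \<parallel>x\<parallel>\<^sub>p\<close>, which gives points \<open>x\<^sub>n\<close> with
  \<open>f x\<^sub>n = 1\<close> and \<open>c p * \<parallel>x\<^sub>n\<parallel>\<^sub>p \<le> 1\<close> for \<open>p \<le> n\<close>. They form a bounded sequence, which by reflexivity
  has a weak cluster point \<open>y\<close>; then \<open>y \<in> C\<close> and \<open>f y = 1\<close>,
  so \<open>f\<close> is not smaller than \<open>1\<close> on \<open>C\<close>.
\<close>

section \<open>The Hahn--Banach theorem\<close>

locale sublinear = vector_space scale
  for scale :: "real \<Rightarrow> 'a::ab_group_add \<Rightarrow> 'a" +
  fixes P :: "'a \<Rightarrow> real"
  assumes subadd: "P (x + y) \<le> P x + P y"
    and pos_homogeneous: "0 \<le> c \<Longrightarrow> P (scale c x) = c * P x"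
begin

lemma sublinear_0: "P 0 = 0"
  using pos_homogeneous[of 0 0] by simp

lemma sublinear_ge: "- P (- x) \<le> P x"
  using subadd[of x "- x"] sublinear_0 by simp

text \<open>An upper estimate for positive factors is enough, because applying it to
  \<open>1/c\<close> gives the reverse inequality. This suits functionals defined as infima.\<close>

lemma sublinearI:
  assumes "\<And>x y. R (x + y) \<le> R x + R y" "R 0 = 0" "\<And>c x. 0 < c \<Longrightarrow> R (scale c x) \<le> c * R x"
  shows "sublinear scale R"
proof
  fix c x assume "(0::real) \<le> c"
  show "R (scale c x) = c * R x"
  proof (cases "c = 0")
    case True
    then show ?thesis by (simp add: assms(2))
  next
    case False
    then have c: "0 < c" using \<open>0 \<le> c\<close> by simp
    have "R x \<le> (1/c) * R (scale c x)"
      using assms(3)[of "1/c" "scale c x"] c by simp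
    then have "c * R x \<le> R (scale c x)" using c by (simp add: field_simps)
    then show ?thesis using assms(3)[OF c, of x] by simp
  qed
qed (fact assms(1))

text \<open>The witness is the infimum of \<open>P (x + y) - q y\<close> over
  \<open>y \<in> K\<close>. The bound at \<open>- y\<close> is what makes every linear functional
  \<open>g\<close> below \<open>R\<close> satisfy \<open>q y \<le> g y\<close> on
  \<open>K\<close>.\<close>

lemma sublinear_inf_cone:
  assumes K0: "0 \<in> K" and Kadd: "\<And>y z. \<lbrakk>y \<in> K; z \<in> K\<rbrakk> \<Longrightarrow> y + z \<in> K"
    and Ksc: "\<And>c y. \<lbrakk>0 \<le> c; y \<in> K\<rbrakk> \<Longrightarrow> scale c y \<in> K"
    and qadd: "\<And>y z. \<lbrakk>y \<in> K; z \<in> K\<rbrakk> \<Longrightarrow> q y + q z \<le> q (y + z)"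
    and qsc: "\<And>c y. \<lbrakk>0 \<le> c; y \<in> K\<rbrakk> \<Longrightarrow> q (scale c y) = c * q y"
    and qP: "\<And>y. y \<in> K \<Longrightarrow> q y \<le> P y"
  obtains R where "sublinear scale R" "\<And>x. R x \<le> P x" "\<And>y. y \<in> K \<Longrightarrow> R (- y) \<le> - q y"
proof
  define R where "R = (\<lambda>x. INF y\<in>K. P (x + y) - q y)"
  have q0: "q 0 = 0" using qsc[of 0 0] K0 by simp
  \<comment> \<open>The infimum is finite:
    \<open>q y \<le> P y \<le> P (x + y) + P (- x)\<close>.\<close>
  have lower: "- P (- x) \<le> P (x + y) - q y" if "y \<in> K" for x y
    using subadd[of "x + y" "- x"] qP[OF that] by simp
  have R_le: "R x \<le> P (x + y) - q y" if "y \<in> K" for x y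
    unfolding R_def using that lower by (intro cINF_lower bdd_belowI2)
  have R_ge: "r \<le> R x" if "\<And>y. y \<in> K \<Longrightarrow> r \<le> P (x + y) - q y" for r x
    unfolding R_def using K0 that by (intro cINF_greatest) auto
  show "R x \<le> P x" for x using R_le[OF K0, of x] q0 by simp
  show "R (- y) \<le> - q y" if "y \<in> K" for y using R_le[OF that, of "- y"] sublinear_0 by simp
  show "sublinear scale R"
  proof (rule sublinearI)
    show "R (x + y) \<le> R x + R y" for x y
    proof -
      \<comment> \<open>The element \<open>w + z\<close> of the cone competes in the infimum at
        \<open>x + y\<close>; the infima over \<open>w\<close> and \<open>z\<close> are then taken
        one after the other.\<close>
      have "R (x + y) - (P (y + z) - q z) \<le> P (x + w) - q w" if w: "w \<in> K" and z: "z \<in> K" for w z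
        using R_le[OF Kadd[OF w z], of "x + y"] qadd[OF w z] subadd[of "x + w" "y + z"]
        by (simp add: algebra_simps)
      then have "R (x + y) - R x \<le> P (y + z) - q z" if "z \<in> K" for z
        using R_ge[of "R (x + y) - (P (y + z) - q z)" x] that by force
      then show ?thesis using R_ge[of "R (x + y) - R x" y] by force
    qed
    show "R 0 = 0"
      using R_le[OF K0, of 0] R_ge[of 0 0] qP q0 sublinear_0 by (force intro: antisym)
    show "R (scale c x) \<le> c * R x" if c: "0 < c" for c x
    proof -
      have "R (scale c x) / c \<le> P (x + y) - q y" if y: "y \<in> K" for y
        using R_le[OF Ksc[of c, OF _ y], of "scale c x"] c qsc[of c y] y pos_homogeneous[of c "x + y"]
        by (simp add: scale_right_distrib field_simps)
      then have "R (scale c x) / c \<le> R x" by (rule R_ge)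
      then show ?thesis using c by (simp add: field_simps)
    qed
  qed
qed

text \<open>Zorn's lemma for the reversed pointwise order. A nonempty chain is bounded below by its
  pointwise infimum, which is finite since every sublinear \<open>R \<le> P\<close> satisfies
  \<open>R x \<ge> - R (- x) \<ge> - P (- x)\<close>.\<close>

lemma exists_minimal_sublinear:
  obtains m where "sublinear scale m" "m \<le> P" "\<And>R. \<lbrakk>sublinear scale R; R \<le> m\<rbrakk> \<Longrightarrow> R = m"
proof -
  let ?A = "{R. sublinear scale R \<and> R \<le> P}"
  have "\<exists>m\<in>?A. \<forall>R\<in>?A. m \<ge> R \<longrightarrow> R = m"
  proof (rule predicate_Zorn)
    show "partial_order_on ?A (relation_of (\<ge>) ?A)"
      by (rule partial_order_on_relation_ofI) auto
    fix C assume "C \<in> Chains (relation_of (\<ge>) ?A)"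
    then have C: "C \<subseteq> ?A" "\<And>R S. \<lbrakk>R \<in> C; S \<in> C\<rbrakk> \<Longrightarrow> R \<le> S \<or> S \<le> R"
      by (auto simp: Chains_def relation_of_def)
    show "\<exists>u\<in>?A. \<forall>R\<in>C. R \<ge> u"
    proof (cases "C = {}")
      case True
      then show ?thesis using sublinear_axioms by blast
    next
      case False
      define u where "u = (\<lambda>x. INF R\<in>C. R x)"
      have sub: "sublinear scale R" "R \<le> P" if "R \<in> C" for R using C(1) that by auto
      have "- P (- x) \<le> R x" if "R \<in> C" for R x
        using sublinear.sublinear_ge[OF sub(1)[OF that], of x] le_funD[OF sub(2)[OF that], of "- x"]
        by linarith
      then have u_le: "u x \<le> R x" if "R \<in> C" for R x
        unfolding u_def using that by (intro cINF_lower bdd_belowI2)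
      have u_ge: "r \<le> u x" if "\<And>R. R \<in> C \<Longrightarrow> r \<le> R x" for r x
        unfolding u_def using False that by (intro cINF_greatest) auto
      have "sublinear scale u"
      proof (rule sublinearI)
        show "u (x + y) \<le> u x + u y" for x y
        proof -
          \<comment> \<open>Two members of a chain have a common lower bound in it, namely the
            smaller one, and its subadditivity passes to the infimum.\<close>
          have "u (x + y) - S y \<le> R x" if R: "R \<in> C" and S: "S \<in> C" for R S
          proof -
            obtain T where T: "T \<in> C" "T \<le> R" "T \<le> S" using C(2)[OF R S] R S by blast
            have "T (x + y) \<le> T x + T y" using sublinear.subadd[OF sub(1)[OF T(1)]] .
            then show ?thesis
              using u_le[OF T(1), of "x + y"] le_funD[OF T(2), of x] le_funD[OF T(3), of y] by linarith
          qed
          then have "u (x + y) - u x \<le> S y" if "S \<in> C" for S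
            using u_ge[of "u (x + y) - S y" x] that by force
          then show ?thesis using u_ge[of "u (x + y) - u x" y] by force
        qed
        show "u 0 = 0"
          using False sublinear.sublinear_0[OF sub(1)] u_le[of _ 0] u_ge[of 0 0] by fastforce
        show "u (scale c x) \<le> c * u x" if c: "0 < c" for c x
        proof -
          have "u (scale c x) / c \<le> R x" if "R \<in> C" for R
            using u_le[OF that, of "scale c x"] sublinear.pos_homogeneous[OF sub(1)[OF that], of c x] c
            by (simp add: field_simps)
          then have "u (scale c x) / c \<le> u x" by (rule u_ge)
          then show ?thesis using c by (simp add: field_simps)
        qed
      qed
      moreover have "u \<le> P"
      proof -
        obtain R where R: "R \<in> C" using False by blast
        then show ?thesis using u_le[OF R] sub(2)[OF R] by (metis le_fun_def order_trans)
      qed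
      ultimately show ?thesis using u_le by (auto intro!: bexI[of _ u] le_funI)
    qed
  qed
  then obtain m where m: "m \<in> ?A" "\<And>R. \<lbrakk>R \<in> ?A; R \<le> m\<rbrakk> \<Longrightarrow> R = m" by blast
  show thesis
    using m by (intro that[of m]) (auto intro: order_trans)
qed

definition ray :: "'a \<Rightarrow> 'a set" where
  "ray z = {scale t z | t. 0 \<le> t}"

lemma ray_cone:
  shows "0 \<in> ray z" "\<lbrakk>x \<in> ray z; y \<in> ray z\<rbrakk> \<Longrightarrow> x + y \<in> ray z"
    "\<lbrakk>0 \<le> c; x \<in> ray z\<rbrakk> \<Longrightarrow> scale c x \<in> ray z" "z \<in> ray z"
proof -
  show "0 \<in> ray z" unfolding ray_def by (auto intro!: exI[of _ 0])
  show "z \<in> ray z" unfolding ray_def by (auto intro!: exI[of _ 1])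
  show "x + y \<in> ray z" if "x \<in> ray z" "y \<in> ray z"
  proof -
    obtain s t where "x = scale s z" "y = scale t z" "0 \<le> s" "0 \<le> t"
      using \<open>x \<in> ray z\<close> \<open>y \<in> ray z\<close> unfolding ray_def by blast
    then show ?thesis unfolding ray_def by (auto intro!: exI[of _ "s + t"] simp: scale_left_distrib)
  qed
  show "scale c x \<in> ray z" if "0 \<le> c" "x \<in> ray z"
  proof -
    obtain t where "x = scale t z" "0 \<le> t"
      using \<open>x \<in> ray z\<close> unfolding ray_def by blast
    then show ?thesis unfolding ray_def using \<open>0 \<le> c\<close> by (auto intro!: exI[of _ "c * t"])
  qed
qed

text \<open>By homogeneity \<open>P\<close> is additive along a half-line, so it can itself serve as
  the minorant \<open>q\<close> there.\<close>

lemma ray_superadd: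
  assumes "x \<in> ray z" "y \<in> ray z"
  shows "P x + P y \<le> P (x + y)"
proof -
  obtain s t where st: "x = scale s z" "y = scale t z" "0 \<le> s" "0 \<le> t"
    using assms unfolding ray_def by blast
  have "P (scale (s + t) z) = P x + P y"
    using st pos_homogeneous[of s z] pos_homogeneous[of t z] pos_homogeneous[of "s + t" z]
    by (simp add: distrib_right)
  then show ?thesis by (simp add: st scale_left_distrib)
qed

text \<open>
  The Mazur--Orlicz form of the Hahn--Banach theorem. A minimal sublinear functional is linear,
  since it cannot be lowered by taking the cone to be a half-line.
\<close>

theorem Mazur_Orlicz:
  assumes K0: "0 \<in> K" and Kadd: "\<And>y z. \<lbrakk>y \<in> K; z \<in> K\<rbrakk> \<Longrightarrow> y + z \<in> K"
    and Ksc: "\<And>c y. \<lbrakk>0 \<le> c; y \<in> K\<rbrakk> \<Longrightarrow> scale c y \<in> K"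
    and qadd: "\<And>y z. \<lbrakk>y \<in> K; z \<in> K\<rbrakk> \<Longrightarrow> q y + q z \<le> q (y + z)"
    and qsc: "\<And>c y. \<lbrakk>0 \<le> c; y \<in> K\<rbrakk> \<Longrightarrow> q (scale c y) = c * q y"
    and qP: "\<And>y. y \<in> K \<Longrightarrow> q y \<le> P y"
  obtains g where "\<And>x y. g (x + y) = g x + g y" "\<And>c x. g (scale c x) = c * g x"
    "\<And>x. g x \<le> P x" "\<And>y. y \<in> K \<Longrightarrow> q y \<le> g y"
proof -
  obtain R where R: "sublinear scale R" "\<And>x. R x \<le> P x" "\<And>y. y \<in> K \<Longrightarrow> R (- y) \<le> - q y"
    using sublinear_inf_cone[OF assms] by blast
  obtain g where g: "sublinear scale g" "g \<le> R"
    and min: "\<And>S. \<lbrakk>sublinear scale S; S \<le> g\<rbrakk> \<Longrightarrow> S = g"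
    using sublinear.exists_minimal_sublinear[OF R(1)] by blast
  interpret g: sublinear scale g by fact
  \<comment> \<open>Taking \<open>g\<close> as its own minorant on the half-line through
    \<open>z\<close> yields a sublinear functional below \<open>g\<close>, which equals
    \<open>g\<close> by minimality. Hence \<open>g\<close> is odd, and an odd sublinear functional
    is linear.\<close>
  have neg: "g (- z) = - g z" for z
  proof -
    obtain S where S: "sublinear scale S" "\<And>x. S x \<le> g x" "\<And>y. y \<in> ray z \<Longrightarrow> S (- y) \<le> - g y"
      by (rule g.sublinear_inf_cone[OF ray_cone(1-3)[where z = z] g.ray_superadd g.pos_homogeneous order_refl]) blast+
    have "S = g" by (rule min[OF S(1)]) (simp add: le_fun_def S(2))
    then have "g (- z) \<le> - g z" using S(3)[OF ray_cone(4)] by simp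
    then show ?thesis using g.sublinear_ge[of z] by simp
  qed
  show thesis
  proof
    show "g (x + y) = g x + g y" for x y
      using g.subadd[of x y] g.subadd[of "- x" "- y"] neg[of x] neg[of y] neg[of "x + y"] by simp
    show "g (scale c x) = c * g x" for c x
    proof (cases "0 \<le> c")
      case False
      then show ?thesis
        using g.pos_homogeneous[of "- c" x] neg[of "scale c x"] by simp
    qed (rule g.pos_homogeneous)
    show "g x \<le> P x" for x using le_funD[OF g(2), of x] R(2)[of x] by simp
    show "q y \<le> g y" if "y \<in> K" for y
      using R(3)[OF that] le_funD[OF g(2), of "- y"] neg[of y] by linarith
  qed
qed

end

section \<open>Complex functionals dominated by seminorms\<close>

locale complex_seminorm = vector_space smul
  for smul :: "complex \<Rightarrow> 'a::ab_group_add \<Rightarrow> 'a" +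
  fixes P :: "'a \<Rightarrow> real"
  assumes seminorm_add: "P (x + y) \<le> P x + P y"
    and seminorm_smul: "P (smul c x) = cmod c * P x"
begin

lemma sublinear_seminorm: "sublinear (\<lambda>r. smul (complex_of_real r)) P"
  by unfold_locales
    (auto simp: seminorm_add seminorm_smul scale_left_distrib scale_right_distrib)

lemma seminorm_minus: "P (- x) = P x"
  using seminorm_smul[of "-1" x] by simp

text \<open>A complex functional with real part \<open>g\<close> has to be
  \<open>g x - i g(i x)\<close>. A bound on the real part bounds the modulus: multiplying
  \<open>x\<close> by a suitable scalar of modulus one makes the value equal to
  \<open>cmod (G x)\<close> and leaves \<open>P x\<close> unchanged.\<close>

lemma complexify_le_seminorm:
  assumes add: "\<And>x y. g (x + y) = g x + g y" and sc: "\<And>r x. g (smul (of_real r) x) = r * g x"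
    and le: "\<And>x. g x \<le> P x"
  obtains G where "linear_functional_on smul UNIV G" "\<And>x. Re (G x) = g x" "\<And>x. cmod (G x) \<le> P x"
proof
  define G where "G = (\<lambda>x. Complex (g x) (- g (smul \<i> x)))"
  have sc': "g (smul (Complex a b) x) = a * g x + b * g (smul \<i> x)" for a b x
  proof -
    have "smul (Complex a b) x = smul (of_real a) x + smul (of_real b) (smul \<i> x)"
      by (simp add: Complex_eq mult.commute flip: scale_left_distrib)
    then show ?thesis by (simp only: add sc)
  qed
  have mult: "G (smul c x) = c * G x" for c x
  proof (cases c)
    case (Complex a b)
    have "g (smul \<i> (smul c x)) = - b * g x + a * g (smul \<i> x)"
      using sc'[of "- b" a x] by (simp add: Complex complex_eq_iff i_complex_of_real) (simp add: Complex_eq algebra_simps)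
    then show ?thesis by (simp add: G_def Complex sc' complex_eq_iff algebra_simps)
  qed
  show "linear_functional_on smul UNIV G"
    by (simp add: linear_functional_on_def mult) (simp add: G_def add scale_right_distrib complex_eq_iff)
  show "Re (G x) = g x" for x by (simp add: G_def)
  show "cmod (G x) \<le> P x" for x
  proof (cases "G x = 0")
    case True
    have "0 \<le> P x" using sublinear.sublinear_ge[OF sublinear_seminorm, of x] by (simp add: seminorm_minus)
    then show ?thesis using True by simp
  next
    case False
    define c where "c = cnj (sgn (G x))"
    have c: "cmod c = 1" using False by (simp add: c_def norm_sgn)
    have "of_real (cmod (G x)) = c * G x"
      using False by (simp add: c_def sgn_eq complex_norm_square[symmetric] mult.commute power2_eq_square)
    then have "cmod (G x) = Re (G (smul c x))" by (metis Re_complex_of_real mult)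
    also have "\<dots> = g (smul c x)" by (simp add: G_def)
    also have "\<dots> \<le> P x" using le[of "smul c x"] c by (simp add: seminorm_smul)
    finally show ?thesis .
  qed
qed

text \<open>With \<open>P\<close> as minorant on the half-line through \<open>a\<close>, the chain
  \<open>P a \<le> g a = Re (G a) \<le> cmod (G a) \<le> P a\<close> collapses.\<close>

lemma Hahn_Banach_norming:
  obtains G where "linear_functional_on smul UNIV G" "\<And>x. cmod (G x) \<le> P x" "cmod (G a) = P a"
proof -
  note sub = sublinear_seminorm
  note cone = sublinear.ray_cone[OF sub, where z = a]
  obtain g where g: "\<And>x y. g (x + y) = g x + g y" "\<And>r x. g (smul (of_real r) x) = r * g x"
      "\<And>x. g x \<le> P x" "\<And>y. y \<in> sublinear.ray (\<lambda>r. smul (complex_of_real r)) a \<Longrightarrow> P y \<le> g y"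
    by (rule sublinear.Mazur_Orlicz[OF sub cone(1-3) sublinear.ray_superadd[OF sub]
          sublinear.pos_homogeneous[OF sub] order_refl]) blast+
  obtain G where G: "linear_functional_on smul UNIV G" "\<And>x. Re (G x) = g x" "\<And>x. cmod (G x) \<le> P x"
    using complexify_le_seminorm[OF g(1-3)] by blast
  have "cmod (G a) = P a"
    using G(2)[of a] G(3)[of a] g(4)[OF cone(4)] complex_Re_le_cmod[of "G a"] by simp
  with G that show thesis by blast
qed

text \<open>The function \<open>Re f - Q\<close> is superadditive and lies below \<open>P\<close>,
  so a real linear \<open>g\<close> fits in between. Then \<open>g\<close> is dominated by
  \<open>P\<close> and \<open>Re f - g\<close> by \<open>Q\<close>, and both are
  complexified.\<close>

lemma linear_functional_split:
  assumes Q: "complex_seminorm smul Q" and f: "linear_functional_on smul UNIV f"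
    and le: "\<And>x. cmod (f x) \<le> P x + Q x"
  obtains g h where "linear_functional_on smul UNIV g" "linear_functional_on smul UNIV h"
    "f = g + h" "\<And>x. cmod (g x) \<le> P x" "\<And>x. cmod (h x) \<le> Q x"
proof -
  interpret Q: complex_seminorm smul Q by fact
  have f_add: "f (x + y) = f x + f y" and f_smul: "f (smul c x) = c * f x" for x y c
    using f by (auto simp: linear_functional_on_def)
  obtain g where g: "\<And>x y. g (x + y) = g x + g y" "\<And>r x. g (smul (of_real r) x) = r * g x"
    "\<And>x. g x \<le> P x" "\<And>x. Re (f x) - Q x \<le> g x"
  proof (rule sublinear.Mazur_Orlicz[OF sublinear_seminorm, of UNIV "\<lambda>x. Re (f x) - Q x"])
    show "Re (f x) - Q x + (Re (f y) - Q y) \<le> Re (f (x + y)) - Q (x + y)" for x y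
      using Q.seminorm_add[of x y] by (simp add: f_add)
    show "Re (f x) - Q x \<le> P x" for x
      using le[of x] complex_Re_le_cmod[of "f x"] by simp
  qed (auto simp: f_smul Q.seminorm_smul algebra_simps)
  obtain G where G: "linear_functional_on smul UNIV G" "\<And>x. Re (G x) = g x" "\<And>x. cmod (G x) \<le> P x"
    using complexify_le_seminorm[OF g(1-3)] by blast
  obtain H where H: "linear_functional_on smul UNIV H" "\<And>x. Re (H x) = Re (f x) - g x" "\<And>x. cmod (H x) \<le> Q x"
  proof (rule Q.complexify_le_seminorm[of "\<lambda>x. Re (f x) - g x"])
    show "Re (f x) - g x \<le> Q x" for x using g(4)[of x] by simp
  qed (auto simp: f_add f_smul g algebra_simps)
  have "f x = G x + H x" for x
  proof -
    \<comment> \<open>A complex linear functional is determined by its real part, so comparing real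
      parts suffices.\<close>
    have Im: "Im (F x) = - Re (F (smul \<i> x))" if "linear_functional_on smul UNIV F" for F
      using that by (simp add: linear_functional_on_def)
    show ?thesis using Im[OF f] Im[OF G(1)] Im[OF H(1)] by (simp add: complex_eq_iff G(2) H(2))
  qed
  then have "f = G + H" by (simp add: fun_eq_iff)
  with G(1,3) H(1,3) that show thesis by blast
qed

end


section \<open>Strong duals of reflexive countably normed spaces\<close>

text \<open>Induction with \<open>linear_functional_split\<close>, splitting off the last seminorm;
  the sum of the others is again a seminorm.\<close>

lemma seminorms_split:
  fixes P :: "nat \<Rightarrow> 'a::ab_group_add \<Rightarrow> real"
  assumes P: "\<And>p. complex_seminorm smul (P p)"
    and f: "linear_functional_on smul UNIV f" "\<And>x. cmod (f x) \<le> (\<Sum>p\<le>n. P p x)"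
  obtains g where "\<And>p. linear_functional_on smul UNIV (g p)" "\<And>p x. cmod (g p x) \<le> P p x"
    "f = (\<Sum>p\<le>n. g p)"
proof -
  have "\<exists>g. (\<forall>p. linear_functional_on smul UNIV (g p) \<and> (\<forall>x. cmod (g p x) \<le> P p x)) \<and> f = (\<Sum>p\<le>n. g p)"
    using f
  proof (induction n arbitrary: f)
    case 0
    \<comment> \<open>Indices outside the sum get the zero functional, which is dominated because
      seminorms are nonnegative.\<close>
    define g where "g = (\<lambda>p::nat. if p = 0 then f else 0)"
    have nonneg: "0 \<le> P p x" for p x
      using sublinear.sublinear_ge[OF complex_seminorm.sublinear_seminorm[OF P], of p x]
        complex_seminorm.seminorm_minus[OF P, of p x] by simp
    have "linear_functional_on smul UNIV (g p) \<and> (\<forall>x. cmod (g p x) \<le> P p x)" for p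
      using 0 nonneg by (simp add: g_def) (simp add: linear_functional_on_def)
    moreover have "f = (\<Sum>p\<le>0. g p)" by (simp add: g_def)
    ultimately show ?case by blast
  next
    case (Suc n)
    have S: "complex_seminorm smul (\<lambda>x. \<Sum>p\<le>n. P p x)"
    proof -
      interpret vector_space smul using P[of 0] by (simp add: complex_seminorm_def)
      show ?thesis
        by unfold_locales
          (auto simp: sum_distrib_left complex_seminorm.seminorm_smul[OF P]
            simp flip: sum.distrib intro!: sum_mono complex_seminorm.seminorm_add[OF P])
    qed
    have "cmod (f x) \<le> (\<Sum>p\<le>n. P p x) + P (Suc n) x" for x
      using Suc.prems(2)[of x] by simp
    then obtain u v where u: "linear_functional_on smul UNIV u" "\<And>x. cmod (u x) \<le> (\<Sum>p\<le>n. P p x)"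
      and v: "linear_functional_on smul UNIV v" "\<And>x. cmod (v x) \<le> P (Suc n) x" and f: "f = u + v"
      using complex_seminorm.linear_functional_split[OF S P Suc.prems(1)] by blast
    obtain g where g: "\<And>p. linear_functional_on smul UNIV (g p)" "\<And>p x. cmod (g p x) \<le> P p x"
      "u = (\<Sum>p\<le>n. g p)"
      using Suc.IH[OF u] by blast
    have "(\<Sum>p\<le>n. (g(Suc n := v)) p) = (\<Sum>p\<le>n. g p)" by (intro sum.cong) auto
    then have "f = (\<Sum>p\<le>Suc n. (g(Suc n := v)) p)" by (simp add: f g(3))
    then show ?case using g v by (intro exI[of _ "g(Suc n := v)"]) auto
  qed
  then show thesis using that by blast
qed

lemma sum_fun_eval: "(\<Sum>i\<in>I. f i) x = (\<Sum>i\<in>I. f i x)"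
  for f :: "'i \<Rightarrow> 'a \<Rightarrow> 'b::comm_monoid_add"
  by (induction I rule: infinite_finite_induct) auto

lemma strong_seminorms_0:
  assumes "p \<in> strong_seminorms S P"
  shows "p 0 = 0"
proof -
  from assms obtain B where "p = (\<lambda>f. SUP x\<in>B. cmod (f x))" "B \<noteq> {}"
    unfolding strong_seminorms_def by blast
  then show ?thesis by simp
qed

text \<open>An uncountable product of compact discs may fail to be sequentially compact, so
  convergence is along a finer filter rather than a subsequence.\<close>

lemma compact_cluster_filter:
  assumes U: "compact U" and X: "\<And>n. X n \<in> U" and F: "F \<noteq> bot"
  obtains y G where "y \<in> U" "G \<noteq> bot" "G \<le> F" "(X \<longlongrightarrow> y) G"
proof -
  have "filtermap X F \<noteq> bot" using F by (simp add: filtermap_bot_iff)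
  moreover have "eventually (\<lambda>y. y \<in> U) (filtermap X F)" using X by (simp add: eventually_filtermap)
  ultimately obtain y where y: "y \<in> U" "inf (nhds y) (filtermap X F) \<noteq> bot"
    using U unfolding compact_filter by blast
  \<comment> \<open>\<open>F\<close> is refined by the preimages of the neighbourhoods of
    \<open>y\<close>; the result is proper because \<open>y\<close> is a cluster point of the image
    filter.\<close>
  let ?G = "inf F (filtercomap X (nhds y))"
  have "?G \<noteq> bot"
  proof
    assume "?G = bot"
    then have "eventually (\<lambda>_. False) ?G" by simp
    then obtain P Q where "eventually P F" "eventually Q (nhds y)" "\<And>n. P n \<Longrightarrow> \<not> Q (X n)"
      unfolding eventually_inf eventually_filtercomap by metis
    then have "eventually (\<lambda>_. False) (inf (nhds y) (filtermap X F))"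
      unfolding eventually_inf eventually_filtermap
      by (intro exI[of _ Q] exI[of _ "\<lambda>z. \<not> Q z"]) (auto elim: eventually_mono)
    then show False using y(2) by (simp add: trivial_limit_def)
  qed
  moreover have "(X \<longlongrightarrow> y) ?G"
    by (rule tendsto_mono[OF inf_le2]) (rule filterlim_filtercomap)
  ultimately show thesis using that[OF y(1)] by simp
qed

interpretation fun_scale: vector_space "fun_scale :: complex \<Rightarrow> ('a \<Rightarrow> complex) \<Rightarrow> 'a \<Rightarrow> complex"
  by standard (auto simp: fun_scale_def fun_eq_iff algebra_simps)

section \<open>The dual of a countably normed space and its strong topology\<close>

context countably_normed_space
begin

lemma seminorm_nrm: "complex_seminorm smul (nrm p)"
proof -
  interpret complex_norm smul "nrm p" by (rule norms)
  show ?thesis by unfold_locales (auto simp: triangle norm_smul)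
qed

lemma nrm_nonneg: "0 \<le> nrm p x"
  by (rule complex_norm.N_nonneg[OF norms])

lemma nrm_0 [simp]: "nrm p 0 = 0"
  by (rule complex_norm.N_0[OF norms])

lemma nrm_smul: "nrm p (smul c x) = cmod c * nrm p x"
  by (rule complex_norm.norm_smul[OF norms])

lemma norm_dual_nrm_iff:
  "f \<in> norm_dual smul (nrm p) \<longleftrightarrow> linear_functional_on smul UNIV f \<and> (\<exists>C. \<forall>x. cmod (f x) \<le> C * nrm p x)"
  by (rule complex_norm.norm_dual_iff[OF norms])

lemma dual_union_iff:
  "f \<in> dual_union smul nrm \<longleftrightarrow>
     linear_functional_on smul UNIV f \<and> (\<exists>p C. \<forall>x. cmod (f x) \<le> C * nrm p x)"
  by (auto simp: dual_union_def norm_dual_nrm_iff)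

lemma dual_unionI:
  assumes "linear_functional_on smul UNIV f" "\<And>x. cmod (f x) \<le> C * nrm p x"
  shows "f \<in> dual_union smul nrm"
  using assms by (auto simp: dual_union_iff)

lemma dual_unionD:
  assumes "f \<in> dual_union smul nrm"
  shows "f (x + y) = f x + f y" "f (smul c x) = c * f x"
  using assms by (auto simp: dual_union_iff linear_functional_on_def)

lemma subspace_dual_union: "fun_scale.subspace (dual_union smul nrm)"
proof (rule fun_scale.subspaceI)
  show "0 \<in> dual_union smul nrm"
    by (rule dual_unionI[where C = 0 and p = 0]) (auto simp: linear_functional_on_def)
next
  fix f g assume f: "f \<in> dual_union smul nrm" and g: "g \<in> dual_union smul nrm"
  obtain p C q C' where C: "\<And>x. cmod (f x) \<le> C * nrm p x" "\<And>x. cmod (g x) \<le> C' * nrm q x"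
    using f g by (auto simp: dual_union_iff)
  let ?m = "max p q"
  have "cmod ((f + g) x) \<le> (\<bar>C\<bar> + \<bar>C'\<bar>) * nrm ?m x" for x
  proof -
    have "C * nrm p x \<le> \<bar>C\<bar> * nrm ?m x" "C' * nrm q x \<le> \<bar>C'\<bar> * nrm ?m x"
      by (auto intro!: mult_mono nondecreasing nrm_nonneg)
    then show ?thesis
      using C[of x] norm_triangle_ineq[of "f x" "g x"] by (simp add: distrib_right)
  qed
  then show "f + g \<in> dual_union smul nrm"
    by (rule dual_unionI[rotated])
      (simp add: linear_functional_on_def dual_unionD[OF f] dual_unionD[OF g] algebra_simps)
next
  fix c f assume f: "f \<in> dual_union smul nrm"
  obtain p C where C: "\<And>x. cmod (f x) \<le> C * nrm p x"
    using f by (auto simp: dual_union_iff)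
  have "cmod (fun_scale c f x) \<le> (cmod c * C) * nrm p x" for x
    using mult_left_mono[OF C[of x], of "cmod c"] by (simp add: fun_scale_def norm_mult mult.assoc)
  then show "fun_scale c f \<in> dual_union smul nrm"
    by (rule dual_unionI[rotated])
      (simp add: linear_functional_on_def fun_scale_def dual_unionD[OF f] algebra_simps)
qed

abbreviation nonempty_bounded :: "'a set \<Rightarrow> bool" where
  "nonempty_bounded B \<equiv> lc_bounded UNIV (range nrm) B \<and> B \<noteq> {}"

text \<open>For nonempty bounded \<open>B\<close> these are the seminorms of the strong topology.
  The supremum is a real one, hence informative only for functionals bounded on \<open>B\<close>,
  such as those in the dual.\<close>

definition sup_on :: "'a set \<Rightarrow> ('a \<Rightarrow> complex) \<Rightarrow> real" where
  "sup_on B f = (SUP x\<in>B. cmod (f x))"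

lemma sup_on_upper:
  "\<lbrakk>f \<in> dual_union smul nrm; nonempty_bounded B; x \<in> B\<rbrakk> \<Longrightarrow> cmod (f x) \<le> sup_on B f"
  unfolding sup_on_def using bdd_above_dual_union by (intro cSUP_upper) auto

lemma sup_on_least: "\<lbrakk>nonempty_bounded B; \<And>x. x \<in> B \<Longrightarrow> cmod (f x) \<le> r\<rbrakk> \<Longrightarrow> sup_on B f \<le> r"
  unfolding sup_on_def by (intro cSUP_least) auto

lemma sup_on_nonneg: "\<lbrakk>f \<in> dual_union smul nrm; nonempty_bounded B\<rbrakk> \<Longrightarrow> 0 \<le> sup_on B f"
  using sup_on_upper by (metis all_not_in_conv norm_ge_zero order_trans)

lemma sup_on_add:
  assumes f: "f \<in> dual_union smul nrm" and g: "g \<in> dual_union smul nrm" and B: "nonempty_bounded B"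
  shows "sup_on B (f + g) \<le> sup_on B f + sup_on B g"
proof (rule sup_on_least[OF B])
  fix x assume "x \<in> B"
  then show "cmod ((f + g) x) \<le> sup_on B f + sup_on B g"
    using sup_on_upper[OF f B] sup_on_upper[OF g B] norm_triangle_ineq[of "f x" "g x"]
    by (fastforce intro: order_trans)
qed

lemma sup_on_scale:
  assumes f: "f \<in> dual_union smul nrm" and B: "nonempty_bounded B"
  shows "sup_on B (fun_scale c f) \<le> cmod c * sup_on B f"
  by (rule sup_on_least[OF B]) (auto simp: fun_scale_def norm_mult intro!: mult_left_mono sup_on_upper[OF f B])

lemma topspace_strong_dual: "topspace (strong_dual_topology smul nrm) = dual_union smul nrm"
  unfolding strong_dual_topology_def
proof (rule topspace_lc_topology)
  show "p 0 = 0" if "p \<in> strong_seminorms UNIV (range nrm)" for p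
    using that by (rule strong_seminorms_0)
  have "lc_bounded UNIV (range nrm) {0}" by (auto simp: lc_bounded_def)
  then show "strong_seminorms UNIV (range nrm) \<noteq> {}" unfolding strong_seminorms_def by blast
qed

lemma openin_strong_dual_ball:
  assumes "f \<in> dual_union smul nrm" "nonempty_bounded B" "0 < e"
  shows "openin (strong_dual_topology smul nrm) {g \<in> dual_union smul nrm. sup_on B (g - f) < e}"
proof -
  have "sup_on B \<in> strong_seminorms UNIV (range nrm)"
    using assms(2) unfolding strong_seminorms_def sup_on_def by blast
  then show ?thesis
    unfolding strong_dual_topology_def lc_topology_def
    using assms(1,3) by (intro topology_generated_by_Basis) blast
qed

text \<open>The balls of single seminorms \<open>sup_on B\<close> form neighbourhood bases, so an
  epsilon estimate at each point suffices. All three algebra operations are treated this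
  way.\<close>

lemma continuous_map_strong_dualI:
  assumes h: "\<And>x. x \<in> topspace X \<Longrightarrow> h x \<in> dual_union smul nrm"
    and nbhd: "\<And>x B e. \<lbrakk>x \<in> topspace X; nonempty_bounded B; 0 < e\<rbrakk> \<Longrightarrow>
      \<exists>W. openin X W \<and> x \<in> W \<and> (\<forall>y\<in>W. sup_on B (h y - h x) < e)"
  shows "continuous_map X (strong_dual_topology smul nrm) h"
  unfolding continuous_map topspace_strong_dual
proof (intro conjI allI impI)
  show "h ` topspace X \<subseteq> dual_union smul nrm" using h by blast
  fix U assume U: "openin (strong_dual_topology smul nrm) U"
  show "openin X {x \<in> topspace X. h x \<in> U}"
  proof (subst openin_subopen, intro ballI)
    fix x assume x: "x \<in> {x \<in> topspace X. h x \<in> U}"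
    then obtain B e where B: "nonempty_bounded B" "0 < e"
      "{b \<in> dual_union smul nrm. sup_on B (b - h x) < e} \<subseteq> U"
      using U unfolding openin_strong_dual_topology sup_on_def by force
    obtain W where "openin X W" "x \<in> W" "\<forall>y\<in>W. sup_on B (h y - h x) < e"
      using nbhd[OF _ B(1,2), of x] x by blast
    then show "\<exists>T. openin X T \<and> x \<in> T \<and> T \<subseteq> {x \<in> topspace X. h x \<in> U}"
      using B(3) h openin_subset by (intro exI[of _ W]) blast
  qed
qed

text \<open>By linearity the bound applies to differences: \<open>F\<close> varies by at most
  \<open>sup_on B (g - f)\<close> between \<open>f\<close> and \<open>g\<close>.\<close>

lemma continuous_dual_strongI:
  assumes F: "F \<in> extensional (dual_union smul nrm)"
    and lin: "linear_functional_on fun_scale (dual_union smul nrm) F"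
    and B: "nonempty_bounded B" "\<And>f. f \<in> dual_union smul nrm \<Longrightarrow> cmod (F f) \<le> sup_on B f"
  shows "F \<in> continuous_dual fun_scale (dual_union smul nrm) (strong_seminorms UNIV (range nrm))"
proof -
  let ?D = "dual_union smul nrm"
  have diff: "F (g - f) = F g - F f" if "g \<in> ?D" "f \<in> ?D" for f g
  proof -
    have "F (g - f + f) = F (g - f) + F f"
      using lin that fun_scale.subspace_diff[OF subspace_dual_union that]
      unfolding linear_functional_on_def by blast
    then show ?thesis by simp
  qed
  have "openin (strong_dual_topology smul nrm) {f \<in> ?D. F f \<in> V}" if V: "open V" for V
  proof (subst openin_subopen, intro ballI)
    fix f assume f: "f \<in> {f \<in> ?D. F f \<in> V}"
    then obtain e where e: "e > 0" "ball (F f) e \<subseteq> V" using V by (auto elim: openE)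
    have "F g \<in> V" if g: "g \<in> ?D" "sup_on B (g - f) < e" for g
    proof -
      have "cmod (F g - F f) < e"
        using B(2)[OF fun_scale.subspace_diff[OF subspace_dual_union g(1)], of f] f g diff by auto
      then show ?thesis using e(2) by (auto simp: dist_norm norm_minus_commute)
    qed
    moreover have "f \<in> {g \<in> ?D. sup_on B (g - f) < e}"
      using f B(1) e(1) by (simp add: sup_on_def)
    moreover have "openin (strong_dual_topology smul nrm) {g \<in> ?D. sup_on B (g - f) < e}"
      using f by (intro openin_strong_dual_ball B(1) e(1)) auto
    ultimately show "\<exists>T. openin (strong_dual_topology smul nrm) T \<and> f \<in> T \<and> T \<subseteq> {f \<in> ?D. F f \<in> V}"
      by blast
  qed
  then have "continuous_map (strong_dual_topology smul nrm) euclidean F"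
    by (simp add: continuous_map topspace_strong_dual open_openin[symmetric])
  with F lin show ?thesis unfolding continuous_dual_def strong_dual_topology_def by simp
qed

text \<open>Surjectivity of the canonical map onto the bidual.\<close>

lemma lc_reflexiveD:
  assumes refl: "lc_reflexive smul UNIV (range nrm)"
    and F: "F \<in> continuous_dual fun_scale (dual_union smul nrm) (strong_seminorms UNIV (range nrm))"
  obtains y where "\<And>f. f \<in> dual_union smul nrm \<Longrightarrow> F f = f y"
proof -
  let ?D = "dual_union smul nrm" and ?Q = "strong_seminorms UNIV (range nrm)"
  let ?T = "lc_topology (continuous_dual fun_scale ?D ?Q) (strong_seminorms ?D ?Q)"
  have "topspace ?T = continuous_dual fun_scale ?D ?Q"
  proof (rule topspace_lc_topology)
    show "p 0 = 0" if "p \<in> strong_seminorms ?D ?Q" for p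
      using that by (rule strong_seminorms_0)
    have "lc_bounded ?D ?Q {0}"
      using fun_scale.subspace_0[OF subspace_dual_union] by (auto simp: lc_bounded_def)
    then show "strong_seminorms ?D ?Q \<noteq> {}"
      unfolding strong_seminorms_def by blast
  qed
  moreover have "homeomorphic_map (lc_topology UNIV (range nrm)) ?T (\<lambda>x. \<lambda>f\<in>?D. f x)"
    using refl unfolding lc_reflexive_def Let_def continuous_dual_eq_dual_union .
  ultimately have "F \<in> (\<lambda>x. \<lambda>f\<in>?D. f x) ` topspace (lc_topology UNIV (range nrm))"
    using F homeomorphic_imp_surjective_map by blast
  then obtain y where "F = (\<lambda>f\<in>?D. f y)" by blast
  then show thesis using that[of y] by simp
qed

text \<open>
  A pointwise cluster point of the evaluations at the sequence is strongly continuous, hence by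
  reflexivity an evaluation itself.
\<close>

lemma reflexive_cluster_point:
  fixes X :: "nat \<Rightarrow> 'a"
  assumes refl: "lc_reflexive smul UNIV (range nrm)"
    and X: "lc_bounded UNIV (range nrm) (range X)"
  obtains y G where "G \<noteq> bot" "G \<le> sequentially"
    "\<And>f. f \<in> dual_union smul nrm \<Longrightarrow> ((\<lambda>n. f (X n)) \<longlongrightarrow> f y) G"
proof -
  let ?D = "dual_union smul nrm" and ?B = "range X"
  have B: "nonempty_bounded ?B" using X by blast
  \<comment> \<open>Evaluation at \<open>X n\<close>, extended by zero to all functions so that it
    is a point of a full product space. These points lie in the box \<open>U\<close>, which is
    compact by Tychonoff's theorem.\<close>
  define \<Phi> where "\<Phi> = (\<lambda>n f. if f \<in> ?D then f (X n) else 0)"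
  define U where "U = (\<Pi>\<^sub>E f\<in>UNIV. cball (0::complex) (if f \<in> ?D then sup_on ?B f else 0))"
  have "compactin (product_topology (\<lambda>_. euclidean) UNIV) U"
    unfolding U_def by (auto simp: compactin_PiE)
  then have "compact U" by (simp add: euclidean_product_topology)
  moreover have \<Phi>_U: "\<Phi> n \<in> U" for n
  proof -
    have "cmod (f (X n)) \<le> sup_on ?B f" if "f \<in> ?D" for f by (rule sup_on_upper[OF that B rangeI])
    then show ?thesis by (simp add: \<Phi>_def U_def PiE_iff)
  qed
  ultimately obtain L G where G: "L \<in> U" "G \<noteq> bot" "G \<le> sequentially" "(\<Phi> \<longlongrightarrow> L) G"
    by (rule compact_cluster_filter[OF _ _ sequentially_bot])
  have \<Phi>_lim: "((\<lambda>n. \<Phi> n f) \<longlongrightarrow> L f) G" for f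
    by (rule continuous_on_tendsto_compose[OF continuous_on_product_coordinates G(4)]) auto
  have lim: "((\<lambda>n. f (X n)) \<longlongrightarrow> L f) G" if "f \<in> ?D" for f
    using that \<Phi>_lim[of f] by (simp add: \<Phi>_def)
  let ?F = "restrict L ?D"
  \<comment> \<open>Linearity passes to pointwise limits. Membership of \<open>L\<close> in the box
    says that \<open>L\<close> is bounded by the strong seminorm of \<open>range X\<close>.\<close>
  have "?F \<in> continuous_dual fun_scale ?D (strong_seminorms UNIV (range nrm))"
  proof (rule continuous_dual_strongI[OF _ _ B])
    show "linear_functional_on fun_scale ?D ?F"
      unfolding linear_functional_on_def
    proof (intro conjI ballI allI)
      fix f g assume fg: "f \<in> ?D" "g \<in> ?D"
      then have "f + g \<in> ?D" by (rule fun_scale.subspace_add[OF subspace_dual_union])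
      then have "((\<lambda>n. f (X n) + g (X n)) \<longlongrightarrow> L (f + g)) G" using lim by fastforce
      then have "L (f + g) = L f + L g"
        using tendsto_add[OF lim[OF fg(1)] lim[OF fg(2)]] tendsto_unique[OF G(2)] by blast
      then show "?F (f + g) = ?F f + ?F g" using fg \<open>f + g \<in> ?D\<close> by simp
    next
      fix c f assume f: "f \<in> ?D"
      then have cf: "fun_scale c f \<in> ?D" by (rule fun_scale.subspace_scale[OF subspace_dual_union])
      have "((\<lambda>n. c * f (X n)) \<longlongrightarrow> L (fun_scale c f)) G"
        using lim[OF cf] by (simp add: fun_scale_def)
      then have "L (fun_scale c f) = c * L f"
        using tendsto_mult_left[OF lim[OF f]] tendsto_unique[OF G(2)] by blast
      then show "?F (fun_scale c f) = c * ?F f" using f cf by simp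
    qed
    show "cmod (?F f) \<le> sup_on ?B f" if "f \<in> ?D" for f
      using G(1) that by (auto simp: U_def PiE_iff dest: spec[of _ f])
  qed auto
  then obtain y where "\<And>f. f \<in> ?D \<Longrightarrow> ?F f = f y" using lc_reflexiveD[OF refl] by blast
  then show thesis using that[OF G(2,3), of y] lim by simp
qed

text \<open>
  The bounded set \<open>{x. \<forall>p. c p * nrm p x \<le> 1}\<close> is the polar of the algebraic sum of the balls of
  radius \<open>c p\<close> in the Banach duals; the lemma says that its polar in turn is no larger
  than that sum, without passing to a closure.
\<close>

lemma reflexive_bipolar:
  assumes refl: "lc_reflexive smul UNIV (range nrm)"
    and c: "\<And>p. 0 < c p" and f: "f \<in> dual_union smul nrm"
    and f1: "\<And>x. (\<And>p. c p * nrm p x \<le> 1) \<Longrightarrow> cmod (f x) < 1"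
  obtains n where "\<And>x. cmod (f x) \<le> (\<Sum>p\<le>n. c p * nrm p x)"
proof (rule ccontr)
  assume "\<not> thesis"
  then have "\<exists>x. \<not> cmod (f x) \<le> (\<Sum>p\<le>n. c p * nrm p x)" for n using that by blast
  then obtain z where z: "\<And>n. (\<Sum>p\<le>n. c p * nrm p (z n)) < cmod (f (z n))"
    by (metis linorder_not_le)
  \<comment> \<open>Failure of the bound is strict, so \<open>f (z n)\<close> is nonzero and can be
    normalised to \<open>1\<close>. Each single summand is then at most \<open>1\<close>.\<close>
  define X where "X = (\<lambda>n. smul (inverse (f (z n))) (z n))"
  have pos: "0 < cmod (f (z n))" for n
    using z[of n] sum_nonneg[of "{..n}" "\<lambda>p. c p * nrm p (z n)"] c nrm_nonneg
    by (smt (verit) mult_nonneg_nonneg)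
  have fX: "f (X n) = 1" for n using pos[of n] by (simp add: X_def dual_unionD[OF f])
  have small: "c p * nrm p (X n) \<le> 1" if "p \<le> n" for p n
  proof -
    have "c p * nrm p (z n) \<le> (\<Sum>p\<le>n. c p * nrm p (z n))"
      using that c nrm_nonneg by (intro member_le_sum) (auto intro!: mult_nonneg_nonneg less_imp_le[OF c])
    then show ?thesis
      using z[of n] pos[of n] by (simp add: X_def nrm_smul norm_inverse norm_divide field_simps)
  qed
  have "lc_bounded UNIV (range nrm) (range X)"
    unfolding lc_bounded_def
  proof (intro conjI ballI)
    fix q assume "q \<in> range nrm"
    then obtain p where q: "q = nrm p" by blast
    \<comment> \<open>The finitely many points with \<open>n < p\<close>, not controlled by
      \<open>small\<close>, are absorbed in the sum.\<close>
    have "nrm p (X n) \<le> 1 / c p + (\<Sum>n<p. nrm p (X n))" for n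
    proof (cases "p \<le> n")
      case True
      then have "nrm p (X n) \<le> 1 / c p" using small[of p n] c[of p] by (simp add: field_simps)
      then show ?thesis using sum_nonneg[of "{..<p}" "\<lambda>n. nrm p (X n)"] nrm_nonneg by force
    next
      case False
      then have "nrm p (X n) \<le> (\<Sum>n<p. nrm p (X n))"
        by (intro member_le_sum) (auto simp: nrm_nonneg)
      then show ?thesis using c[of p] by (simp add: add_increasing)
    qed
    then show "bdd_above (q ` range X)" unfolding q by (auto intro!: bdd_aboveI2 simp: image_image)
  qed simp
  then obtain y G where G: "G \<noteq> bot" "G \<le> sequentially"
    and lim: "\<And>g. g \<in> dual_union smul nrm \<Longrightarrow> ((\<lambda>n. g (X n)) \<longlongrightarrow> g y) G"
    using reflexive_cluster_point[OF refl] by blast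
  have "f y = 1" using lim[OF f] G(1) by (simp add: fX tendsto_const_iff)
  moreover have "c p * nrm p y \<le> 1" for p
  proof -
    \<comment> \<open>Norms need not converge along \<open>G\<close>, but functionals do. A
      functional norming \<open>y\<close> carries the bound, valid from \<open>n = p\<close> on,
      over to \<open>y\<close>.\<close>
    obtain g where g: "linear_functional_on smul UNIV g" "\<And>x. cmod (g x) \<le> nrm p x" "cmod (g y) = nrm p y"
      using complex_seminorm.Hahn_Banach_norming[OF seminorm_nrm] by blast
    have "g \<in> dual_union smul nrm" using g by (intro dual_unionI[where C = 1 and p = p]) auto
    then have "((\<lambda>n. c p * cmod (g (X n))) \<longlongrightarrow> c p * cmod (g y)) G"
      by (intro tendsto_mult_left tendsto_norm lim)
    moreover have "eventually (\<lambda>n. c p * cmod (g (X n)) \<le> 1) sequentially"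
    proof (rule eventually_sequentiallyI)
      show "c p * cmod (g (X n)) \<le> 1" if "p \<le> n" for n
        using small[OF that] mult_left_mono[OF g(2)[of "X n"], of "c p"] c[of p] by linarith
    qed
    then have "eventually (\<lambda>n. c p * cmod (g (X n)) \<le> 1) G" by (rule filter_leD[OF G(2)])
    ultimately show ?thesis unfolding g(3) by (rule tendsto_upperbound[OF _ _ G(1)])
  qed
  ultimately show False using f1[of y] by simp
qed

end


section \<open>Multiplication in strong algebras\<close>

context complex_norm
begin

lemma norm_dual_norm_le:
  assumes f: "linear_functional_on smul UNIV f" and le: "\<And>x. cmod (f x) \<le> C * N x" and C: "0 \<le> C"
  shows "norm_dual_norm smul N f \<le> C"
proof -
  have "f \<in> norm_dual smul N" using f le norm_dual_iff by blast
  then have "norm_dual_norm smul N f = (SUP x\<in>{x. N x \<le> 1}. cmod (f x))" by (rule norm_dual_norm_eq)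
  also have "\<dots> \<le> C"
  proof (rule cSUP_least)
    show "{x. N x \<le> 1} \<noteq> {}" by (auto intro!: exI[of _ 0])
    show "cmod (f x) \<le> C" if "x \<in> {x. N x \<le> 1}" for x
      using le[of x] that C mult_left_mono[of "N x" 1 C] by simp
  qed
  finally show ?thesis .
qed

lemma norm_dual_bdd_above:
  assumes f: "f \<in> norm_dual smul N"
  shows "bdd_above ((\<lambda>x. cmod (f x)) ` {x. N x \<le> 1})"
proof -
  obtain C where C: "\<And>x. cmod (f x) \<le> C * N x"
    using f norm_dual_iff by blast
  show ?thesis
  proof (rule bdd_aboveI2)
    show "cmod (f x) \<le> \<bar>C\<bar>" if "x \<in> {x. N x \<le> 1}" for x
      using C[of x] that mult_mono[of C "\<bar>C\<bar>" "N x" 1] N_nonneg[of x] abs_ge_self[of C] by simp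
  qed
qed

lemma norm_dual_norm_nonneg: "f \<in> norm_dual smul N \<Longrightarrow> 0 \<le> norm_dual_norm smul N f"
  unfolding norm_dual_norm_eq by (rule cSUP_upper2[OF norm_dual_bdd_above, of _ 0]) simp_all

lemma norm_dual_norm_bound:
  assumes f: "f \<in> norm_dual smul N"
  shows "cmod (f x) \<le> norm_dual_norm smul N f * N x"
proof -
  obtain C where C: "\<And>x. cmod (f x) \<le> C * N x" and lin: "linear_functional_on smul UNIV f"
    using f norm_dual_iff by blast
  have f_smul: "f (smul c x) = c * f x" for c x using lin by (simp add: linear_functional_on_def)
  note bdd = norm_dual_bdd_above[OF f]
  show ?thesis
  proof (cases "N x = 0")
    case True
    then show ?thesis using C[of x] by simp
  next
    case False
    then have pos: "0 < N x" using N_nonneg[of x] by simp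
    let ?y = "smul (of_real (1 / N x)) x"
    have "cmod (f ?y) \<le> norm_dual_norm smul N f"
      unfolding norm_dual_norm_eq[OF f]
      by (rule cSUP_upper[OF _ bdd]) (use pos in \<open>simp add: norm_smul norm_divide\<close>)
    then have "cmod (f x) / N x \<le> norm_dual_norm smul N f"
      using pos by (simp add: f_smul norm_mult norm_divide)
    then show ?thesis using pos by (simp add: field_simps)
  qed
qed

end

section \<open>Bounds for products and joint continuity\<close>

context strong_algebra
begin

lemma
  shows prd_closed: "\<lbrakk>a \<in> dual_union smul nrm; b \<in> dual_union smul nrm\<rbrakk> \<Longrightarrow> prd a b \<in> dual_union smul nrm"
    and prd_add_left: "\<lbrakk>a \<in> dual_union smul nrm; b \<in> dual_union smul nrm; c \<in> dual_union smul nrm\<rbrakk>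
      \<Longrightarrow> prd (a + b) c = prd a c + prd b c"
    and prd_add_right: "\<lbrakk>a \<in> dual_union smul nrm; b \<in> dual_union smul nrm; c \<in> dual_union smul nrm\<rbrakk>
      \<Longrightarrow> prd a (b + c) = prd a b + prd a c"
    and prd_scale_left: "\<lbrakk>a \<in> dual_union smul nrm; b \<in> dual_union smul nrm\<rbrakk>
      \<Longrightarrow> prd (fun_scale z a) b = fun_scale z (prd a b)"
    and prd_scale_right: "\<lbrakk>a \<in> dual_union smul nrm; b \<in> dual_union smul nrm\<rbrakk>
      \<Longrightarrow> prd a (fun_scale z b) = fun_scale z (prd a b)"
  using algebra unfolding complex_algebra_on_def by blast+

lemmas dual_union_closed =
  fun_scale.subspace_0[OF subspace_dual_union] fun_scale.subspace_add[OF subspace_dual_union]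
  fun_scale.subspace_diff[OF subspace_dual_union] fun_scale.subspace_scale[OF subspace_dual_union]
  fun_scale.subspace_sum[OF subspace_dual_union] prd_closed

text \<open>Expansion around \<open>(a', b')\<close>: every term on the right contains an increment,
  so estimates for products near zero, rescaled, give continuity everywhere.\<close>

lemma prd_diff:
  assumes a: "a \<in> dual_union smul nrm" "a' \<in> dual_union smul nrm"
    and b: "b \<in> dual_union smul nrm" "b' \<in> dual_union smul nrm"
  shows "prd a b - prd a' b' = prd (a - a') (b - b') + (prd a' (b - b') + prd (a - a') b')"
proof -
  have "prd ((a - a') + a') ((b - b') + b') =
      (prd (a - a') (b - b') + prd a' (b - b')) + (prd (a - a') b' + prd a' b')"
    by (simp only: prd_add_left prd_add_right dual_union_closed a b)
  then show ?thesis by (simp add: algebra_simps)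
qed

lemma prd_sum_left:
  assumes g: "\<And>i. g i \<in> dual_union smul nrm" and b: "b \<in> dual_union smul nrm"
  shows "prd (\<Sum>i\<le>(n::nat). g i) b = (\<Sum>i\<le>n. prd (g i) b)"
proof (induction n)
  case (Suc n)
  then show ?case by (simp only: sum.atMost_Suc prd_add_left dual_union_closed g b)
qed simp

lemma prd_sum_right:
  assumes g: "\<And>i. g i \<in> dual_union smul nrm" and b: "b \<in> dual_union smul nrm"
  shows "prd b (\<Sum>i\<le>(n::nat). g i) = (\<Sum>i\<le>n. prd b (g i))"
proof (induction n)
  case (Suc n)
  then show ?case by (simp only: sum.atMost_Suc prd_add_right dual_union_closed g b)
qed simp

text \<open>The factor \<open>b\<close> is moved to a dual with index far enough above
  \<open>p\<close> for the strong algebra inequality to apply; its norm does not grow there. A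
  bounded set \<open>B\<close> is bounded in that norm too.\<close>

lemma prd_bounded_on_norm_duals:
  assumes B: "nonempty_bounded B"
  obtains M where "0 \<le> M"
    "\<And>a b \<alpha> \<beta> x. \<lbrakk>linear_functional_on smul UNIV a; \<And>x. cmod (a x) \<le> \<alpha> * nrm p x; 0 \<le> \<alpha>;
       linear_functional_on smul UNIV b; \<And>x. cmod (b x) \<le> \<beta> * nrm q x; 0 \<le> \<beta>; x \<in> B\<rbrakk>
     \<Longrightarrow> cmod (prd a b x) \<le> M * (\<alpha> * \<beta>)"
proof -
  obtain d where d: "\<forall>q p. p > q + d \<longrightarrow>
      (\<exists>K>0. \<forall>a\<in>norm_dual smul (nrm q). \<forall>b\<in>norm_dual smul (nrm p).
         prd a b \<in> norm_dual smul (nrm p) \<and> prd b a \<in> norm_dual smul (nrm p)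
       \<and> norm_dual_norm smul (nrm p) (prd a b)
           \<le> K * norm_dual_norm smul (nrm q) a * norm_dual_norm smul (nrm p) b
       \<and> norm_dual_norm smul (nrm p) (prd b a)
           \<le> K * norm_dual_norm smul (nrm q) a * norm_dual_norm smul (nrm p) b)"
    using mult_bound by blast
  \<comment> \<open>Large enough for both \<open>m > p + d\<close> and
    \<open>q \<le> m\<close>.\<close>
  define m where "m = max p q + d + 1"
  have "m > p + d" unfolding m_def by simp
  then obtain K where K: "K > 0" "\<And>a b. \<lbrakk>a \<in> norm_dual smul (nrm p); b \<in> norm_dual smul (nrm m)\<rbrakk> \<Longrightarrow>
      prd a b \<in> norm_dual smul (nrm m) \<and> norm_dual_norm smul (nrm m) (prd a b)
           \<le> K * norm_dual_norm smul (nrm p) a * norm_dual_norm smul (nrm m) b"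
    using d by metis
  obtain r where r: "\<And>x. x \<in> B \<Longrightarrow> nrm m x \<le> r"
    using B by (simp add: lc_bounded_def bdd_above_def) blast
  have "0 \<le> r" using B r nrm_nonneg by (metis all_not_in_conv order_trans)
  show thesis
  proof
    \<comment> \<open>The constant of the algebra inequality times a bound for \<open>nrm m\<close>
      on \<open>B\<close>.\<close>
    show "0 \<le> K * r" using K(1) \<open>0 \<le> r\<close> by simp
    fix a b \<alpha> \<beta> x
    assume a: "linear_functional_on smul UNIV a" "\<And>x. cmod (a x) \<le> \<alpha> * nrm p x" "0 \<le> \<alpha>"
      and b: "linear_functional_on smul UNIV b" "\<And>x. cmod (b x) \<le> \<beta> * nrm q x" "0 \<le> \<beta>" and x: "x \<in> B"
    have b': "cmod (b x) \<le> \<beta> * nrm m x" for x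
    proof -
      have "q \<le> m" by (simp add: m_def)
      then show ?thesis using b(2)[of x] mult_left_mono[OF nondecreasing b(3)] order_trans by blast
    qed
    have a_in: "a \<in> norm_dual smul (nrm p)" and b_in: "b \<in> norm_dual smul (nrm m)"
      using a b(1) b' norm_dual_nrm_iff by blast+
    let ?na = "norm_dual_norm smul (nrm p) a" and ?nb = "norm_dual_norm smul (nrm m) b"
    have na: "?na \<le> \<alpha>" by (rule complex_norm.norm_dual_norm_le[OF norms a])
    have nb: "?nb \<le> \<beta>" by (rule complex_norm.norm_dual_norm_le[OF norms b(1) b' b(3)])
    note nonneg = complex_norm.norm_dual_norm_nonneg[OF norms]
    have "cmod (prd a b x) \<le> norm_dual_norm smul (nrm m) (prd a b) * nrm m x"
      using K(2)[OF a_in b_in] by (intro complex_norm.norm_dual_norm_bound[OF norms]) blast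
    also have "\<dots> \<le> (K * ?na * ?nb) * r"
      using K(2)[OF a_in b_in] r[OF x] nonneg a_in b_in K(1)
      by (intro mult_mono) (auto simp: nrm_nonneg)
    also have "\<dots> \<le> (K * \<alpha> * \<beta>) * r"
      using K(1) na nb nonneg[OF a_in] nonneg[OF b_in] \<open>0 \<le> r\<close> a(3)
      by (intro mult_right_mono mult_mono) auto
    finally show "cmod (prd a b x) \<le> K * r * (\<alpha> * \<beta>)" by (simp add: ac_simps)
  qed
qed

text \<open>One sequence of radii \<open>c p\<close> has to control all products of components,
  although the constants \<open>M p q\<close> depend on both indices; they are therefore first
  dominated by products \<open>L p * L q\<close>.\<close>

lemma prd_unit_bound:
  assumes B: "nonempty_bounded B"
  obtains C where "nonempty_bounded C"
    "\<And>a b. \<lbrakk>a \<in> dual_union smul nrm; b \<in> dual_union smul nrm; sup_on C a < 1; sup_on C b < 1\<rbrakk>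
      \<Longrightarrow> sup_on B (prd a b) \<le> 1"
proof -
  let ?D = "dual_union smul nrm"
  have "\<exists>M. 0 \<le> M \<and> (\<forall>a b \<alpha> \<beta>. linear_functional_on smul UNIV a \<longrightarrow> (\<forall>x. cmod (a x) \<le> \<alpha> * nrm p x) \<longrightarrow>
      0 \<le> \<alpha> \<longrightarrow> linear_functional_on smul UNIV b \<longrightarrow> (\<forall>x. cmod (b x) \<le> \<beta> * nrm q x) \<longrightarrow> 0 \<le> \<beta> \<longrightarrow>
      (\<forall>x\<in>B. cmod (prd a b x) \<le> M * (\<alpha> * \<beta>)))" for p q
    using prd_bounded_on_norm_duals[OF B, of p q] by metis
  then obtain M where M0: "\<And>p q. 0 \<le> M p q" and
    M: "\<And>p q a b \<alpha> \<beta> x. \<lbrakk>linear_functional_on smul UNIV a; \<And>x. cmod (a x) \<le> \<alpha> * nrm p x; 0 \<le> \<alpha>;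
       linear_functional_on smul UNIV b; \<And>x. cmod (b x) \<le> \<beta> * nrm q x; 0 \<le> \<beta>; x \<in> B\<rbrakk>
     \<Longrightarrow> cmod (prd a b x) \<le> M p q * (\<alpha> * \<beta>)"
    by metis
  \<comment> \<open>\<open>L n\<close> dominates every constant with both indices at most
    \<open>n\<close>. The summand \<open>1\<close> gives \<open>L \<ge> 1\<close>, so the value of
    \<open>L\<close> at the larger index is at most \<open>L p * L q\<close>.\<close>
  define L where "L = (\<lambda>n. 1 + (\<Sum>p\<le>n. \<Sum>q\<le>n. M p q))"
  have L1: "1 \<le> L n" for n unfolding L_def using M0 by (simp add: sum_nonneg)
  have M_le: "M p q \<le> L n" if "p \<le> n" "q \<le> n" for p q n
  proof -
    have "M p q \<le> (\<Sum>q\<le>n. M p q)" using that M0 by (intro member_le_sum) auto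
    also have "\<dots> \<le> (\<Sum>p\<le>n. \<Sum>q\<le>n. M p q)"
      using that M0 by (intro member_le_sum[of p _ "\<lambda>p. \<Sum>q\<le>n. M p q"]) (auto intro: sum_nonneg)
    finally show ?thesis by (simp add: L_def)
  qed
  have M_prod: "M p q \<le> L p * L q" for p q
  proof (cases "p \<le> q")
    case True
    moreover have "1 * L q \<le> L p * L q" using L1[of p] L1[of q] by (intro mult_right_mono) auto
    ultimately show ?thesis using M_le[of p q q] by simp
  next
    case False
    moreover have "L p * 1 \<le> L p * L q" using L1[of p] L1[of q] by (intro mult_left_mono) auto
    ultimately show ?thesis using M_le[of p p q] by simp
  qed
  \<comment> \<open>Dividing by \<open>L n\<close> cancels the constants; the remaining weights
    \<open>(1/2)^n / 2\<close> have partial sums at most \<open>1\<close>.\<close>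
  define c where "c = (\<lambda>n::nat. (1/2) ^ n / (2 * L n))"
  have Lpos: "0 < L n" for n using L1[of n] by simp
  have c: "0 < c n" for n using Lpos[of n] by (simp add: c_def)
  have Mcc: "M p q * (c p * c q) \<le> ((1/2)^p / 2) * ((1/2)^q / 2)" for p q
  proof -
    have "M p q * (c p * c q) \<le> (L p * L q) * (c p * c q)"
      using M_prod c[of p] c[of q] by (intro mult_right_mono) auto
    also have "\<dots> = ((1/2)^p / 2) * ((1/2)^q / 2)"
      using Lpos[of p] Lpos[of q] by (simp add: c_def field_simps)
    finally show ?thesis .
  qed
  have geo: "(\<Sum>p\<le>n. (1/2)^p / 2 :: real) \<le> 1" for n
  proof -
    have "(\<Sum>p\<le>n. (1/2)^p / 2 :: real) = 1 - (1/2) ^ Suc n"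
      by (induction n) (simp_all add: field_simps)
    then show ?thesis by simp
  qed
  let ?C = "{x. \<forall>p. c p * nrm p x \<le> 1}"
  have C: "nonempty_bounded ?C"
  proof
    have "nrm p x \<le> 1 / c p" if "x \<in> ?C" for p x
      using that c[of p] by (simp add: field_simps)
    then show "lc_bounded UNIV (range nrm) ?C"
      unfolding lc_bounded_def by (auto intro!: bdd_aboveI2)
    have "0 \<in> ?C" by simp
    then show "?C \<noteq> {}" by blast
  qed
  \<comment> \<open>Smallness on \<open>?C\<close> gives domination by a finite sum of weighted
    norms through \<open>reflexive_bipolar\<close>, and \<open>seminorms_split\<close> distributes
    the functional over the summands.\<close>
  have decomp: "\<exists>n g. (\<forall>p. linear_functional_on smul UNIV (g p)) \<and> (\<forall>p x. cmod (g p x) \<le> c p * nrm p x)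
      \<and> f = (\<Sum>p\<le>n. g p)" if f: "f \<in> ?D" "sup_on ?C f < 1" for f
  proof -
    have f1: "cmod (f x) < 1" if "\<And>p. c p * nrm p x \<le> 1" for x
      using sup_on_upper[OF f(1) C, of x] f(2) that by fastforce
    obtain n where n: "\<And>x. cmod (f x) \<le> (\<Sum>p\<le>n. c p * nrm p x)"
      by (rule reflexive_bipolar[where c = c and f = f, OF reflexive c f(1)]) (use f1 in blast)+
    have "complex_seminorm smul (\<lambda>x. c p * nrm p x)" for p
    proof
      show "c p * nrm p (x + y) \<le> c p * nrm p x + c p * nrm p y" for x y
        using mult_left_mono[OF complex_seminorm.seminorm_add[OF seminorm_nrm] less_imp_le[OF c[of p]]]
        by (simp only: distrib_left)
      show "c p * nrm p (smul z x) = cmod z * (c p * nrm p x)" for z x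
        by (simp add: nrm_smul)
    qed
    moreover have "linear_functional_on smul UNIV f" using f(1) by (simp add: dual_union_iff)
    ultimately show ?thesis
      using n
    proof (rule seminorms_split[where P = "\<lambda>p x. c p * nrm p x"])
      fix g assume "\<And>p. linear_functional_on smul UNIV (g p)"
        "\<And>p x. cmod (g p x) \<le> c p * nrm p x" "f = (\<Sum>p\<le>n. g p)"
      then show ?thesis by blast
    qed
  qed
  show thesis
  proof (rule that[OF C], goal_cases)
    case (1 a b)
    then have a: "a \<in> ?D" "sup_on ?C a < 1" and b: "b \<in> ?D" "sup_on ?C b < 1" by simp_all
    obtain n g where g: "\<And>p. linear_functional_on smul UNIV (g p)"
        "\<And>p x. cmod (g p x) \<le> c p * nrm p x" "a = (\<Sum>p\<le>n. g p)"
      using decomp[OF a] by blast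
    obtain k h where h: "\<And>q. linear_functional_on smul UNIV (h q)"
        "\<And>q x. cmod (h q x) \<le> c q * nrm q x" "b = (\<Sum>q\<le>k. h q)"
      using decomp[OF b] by blast
    have gD: "g p \<in> ?D" and hD: "h p \<in> ?D" for p
      using dual_unionI[OF g(1,2)] dual_unionI[OF h(1,2)] by auto
    have prd: "prd a b = (\<Sum>p\<le>n. \<Sum>q\<le>k. prd (g p) (h q))"
      unfolding g(3) h(3) by (simp add: prd_sum_left prd_sum_right gD hD dual_union_closed)
        (rule sum.swap)
    show "sup_on B (prd a b) \<le> 1"
    proof (rule sup_on_least[OF B])
      fix x assume x: "x \<in> B"
      have "cmod (prd a b x) = cmod (\<Sum>p\<le>n. \<Sum>q\<le>k. prd (g p) (h q) x)"
        by (simp add: prd sum_fun_eval)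
      also have "\<dots> \<le> (\<Sum>p\<le>n. \<Sum>q\<le>k. cmod (prd (g p) (h q) x))"
        by (intro order_trans[OF norm_sum] sum_mono norm_sum)
      also have "\<dots> \<le> (\<Sum>p\<le>n. \<Sum>q\<le>k. ((1/2)^p / 2) * ((1/2)^q / 2))"
      proof (intro sum_mono)
        fix p q
        have "cmod (prd (g p) (h q) x) \<le> M p q * (c p * c q)"
          by (rule M[OF g(1,2) less_imp_le[OF c] h(1,2) less_imp_le[OF c] x])
        then show "cmod (prd (g p) (h q) x) \<le> ((1/2)^p / 2) * ((1/2)^q / 2)"
          using Mcc[of p q] by linarith
      qed
      also have "\<dots> = (\<Sum>p\<le>n. (1/2)^p / 2) * (\<Sum>q\<le>k. (1/2)^q / 2)"
        by (simp only: sum_product)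
      also have "\<dots> \<le> 1 * 1"
        by (intro mult_mono geo) (auto intro!: sum_nonneg)
      finally show "cmod (prd a b x) \<le> 1" by simp
    qed
  qed
qed

text \<open>Rescaling of \<open>prd_unit_bound\<close>. Strict bounds \<open>s\<close> and
  \<open>t\<close> are used because the seminorms may vanish, whereas division needs positive
  numbers.\<close>

lemma prd_strong_bound:
  assumes B: "nonempty_bounded B"
  obtains C where "nonempty_bounded C"
    "\<And>a b s t. \<lbrakk>a \<in> dual_union smul nrm; b \<in> dual_union smul nrm; sup_on C a < s; sup_on C b < t\<rbrakk>
      \<Longrightarrow> sup_on B (prd a b) \<le> s * t"
proof -
  let ?D = "dual_union smul nrm"
  obtain C where C: "nonempty_bounded C"
    "\<And>a b. \<lbrakk>a \<in> ?D; b \<in> ?D; sup_on C a < 1; sup_on C b < 1\<rbrakk> \<Longrightarrow> sup_on B (prd a b) \<le> 1"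
    using prd_unit_bound[OF B] by blast
  show thesis
  proof (rule that[OF C(1)])
    fix a b s t assume a: "a \<in> ?D" and b: "b \<in> ?D" and s: "sup_on C a < s" and t: "sup_on C b < t"
    have pos: "0 < s" "0 < t"
      using sup_on_nonneg[OF a C(1)] sup_on_nonneg[OF b C(1)] s t by auto
    have small: "sup_on C (fun_scale (of_real (1 / r)) f) < 1" if "f \<in> ?D" "sup_on C f < r" "0 < r" for f r
    proof -
      have "sup_on C (fun_scale (of_real (1 / r)) f) \<le> 1 / r * sup_on C f"
        using sup_on_scale[OF that(1) C(1), of "of_real (1 / r)"] that(3) by (simp add: norm_divide)
      also have "\<dots> < 1" using that(2,3) by simp
      finally show ?thesis .
    qed
    let ?a = "fun_scale (of_real (1 / s)) a" and ?b = "fun_scale (of_real (1 / t)) b"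
    have D: "?a \<in> ?D" "?b \<in> ?D" by (rule dual_union_closed(4), fact)+
    have le1: "sup_on B (prd ?a ?b) \<le> 1"
      by (rule C(2)[OF D small[OF a s pos(1)] small[OF b t pos(2)]])
    have "prd (fun_scale (of_real s) ?a) (fun_scale (of_real t) ?b)
        = fun_scale (of_real t) (fun_scale (of_real s) (prd ?a ?b))"
      by (simp only: prd_scale_left prd_scale_right dual_union_closed D)
    then have "prd a b = fun_scale (of_real (s * t)) (prd ?a ?b)"
      using pos by (simp add: fun_scale_def mult.assoc mult.left_commute)
    then have "sup_on B (prd a b) \<le> (s * t) * sup_on B (prd ?a ?b)"
      using sup_on_scale[OF prd_closed[OF D] B, of "of_real (s * t)"] pos by (simp add: norm_mult)
    also have "\<dots> \<le> s * t" using le1 pos by (simp add: mult_left_le)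
    finally show "sup_on B (prd a b) \<le> s * t" .
  qed
qed

lemma continuous_map_prd:
  "continuous_map (prod_topology (strong_dual_topology smul nrm) (strong_dual_topology smul nrm))
     (strong_dual_topology smul nrm) (\<lambda>(a, b). prd a b)"
proof (rule continuous_map_strong_dualI, goal_cases)
  case (1 z)
  then show ?case by (auto simp: topspace_strong_dual dual_union_closed)
next
  case (2 z B e)
  let ?D = "dual_union smul nrm"
  obtain a b where z: "z = (a, b)" and a: "a \<in> ?D" and b: "b \<in> ?D"
    using 2(1) by (auto simp: topspace_strong_dual)
  obtain C where C: "nonempty_bounded C"
    "\<And>a b s t. \<lbrakk>a \<in> ?D; b \<in> ?D; sup_on C a < s; sup_on C b < t\<rbrakk> \<Longrightarrow> sup_on B (prd a b) \<le> s * t"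
    using prd_strong_bound[OF 2(2)] by blast
  \<comment> \<open>Strict bounds for \<open>a\<close> and \<open>b\<close> themselves, which are
    factors of the mixed terms in \<open>prd_diff\<close>.\<close>
  define s t where "s = sup_on C a + 1" and "t = sup_on C b + 1"
  have st: "0 < s" "0 < t" "sup_on C a < s" "sup_on C b < t"
    using sup_on_nonneg[OF a C(1)] sup_on_nonneg[OF b C(1)] by (auto simp: s_def t_def)
  \<comment> \<open>The three terms of \<open>prd_diff\<close> are at most \<open>r * r\<close>,
    \<open>s * r\<close> and \<open>r * t\<close>; as \<open>r \<le> 1\<close>, their sum is at most
    \<open>r * (1 + s + t) \<le> e / 2\<close>.\<close>
  define r where "r = min 1 (e / (2 * (1 + s + t)))"
  have r: "0 < r" "r \<le> 1" "r * (1 + s + t) < e"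
  proof -
    show "0 < r" "r \<le> 1" using st 2(3) by (auto simp: r_def)
    have "r * (1 + s + t) \<le> (e / (2 * (1 + s + t))) * (1 + s + t)"
      using st by (intro mult_right_mono) (auto simp: r_def)
    also have "\<dots> = e / 2" using st by (simp add: field_simps)
    finally show "r * (1 + s + t) < e" using 2(3) by simp
  qed
  let ?V = "\<lambda>f. {g \<in> ?D. sup_on C (g - f) < r}"
  have bound: "sup_on B (prd a' b' - prd a b) < e" if "a' \<in> ?V a" "b' \<in> ?V b" for a' b'
  proof -
    have D: "a' \<in> ?D" "b' \<in> ?D" "a' - a \<in> ?D" "b' - b \<in> ?D"
      using that a b by (auto intro: dual_union_closed)
    have "sup_on B (prd a' b' - prd a b) \<le> sup_on B (prd (a' - a) (b' - b))
        + (sup_on B (prd a (b' - b)) + sup_on B (prd (a' - a) b))"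
      unfolding prd_diff[OF D(1) a D(2) b]
      using D a b by (intro order_trans[OF sup_on_add] add_left_mono sup_on_add 2 dual_union_closed)
    also have "\<dots> \<le> r * r + (s * r + r * t)"
      using that D a b st by (intro add_mono C(2)) auto
    also have "\<dots> \<le> r * (1 + s + t)"
      using mult_left_mono[OF r(2), of r] r(1) by (simp add: algebra_simps)
    finally show ?thesis using r(3) by simp
  qed
  have "openin (prod_topology (strong_dual_topology smul nrm) (strong_dual_topology smul nrm)) (?V a \<times> ?V b)"
    by (simp add: openin_prod_Times_iff openin_strong_dual_ball a b C(1) r(1))
  moreover have "z \<in> ?V a \<times> ?V b"
    using C(1) r(1) a b by (simp add: z sup_on_def)
  ultimately show ?case
    using bound by (intro exI[of _ "?V a \<times> ?V b"]) (auto simp: z)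
qed

end

section \<open>Continuity of the vector space operations\<close>

context countably_normed_space
begin

lemma continuous_map_dual_add:
  "continuous_map (prod_topology (strong_dual_topology smul nrm) (strong_dual_topology smul nrm))
     (strong_dual_topology smul nrm) (\<lambda>(a, b). a + b)"
proof (rule continuous_map_strong_dualI, goal_cases)
  case (1 z)
  then show ?case
    by (auto simp: topspace_strong_dual intro: fun_scale.subspace_add[OF subspace_dual_union])
next
  case (2 z B e)
  let ?D = "dual_union smul nrm"
  obtain a b where z: "z = (a, b)" and a: "a \<in> ?D" and b: "b \<in> ?D"
    using 2(1) by (auto simp: topspace_strong_dual)
  let ?V = "\<lambda>f. {g \<in> ?D. sup_on B (g - f) < e / 2}"
  have bound: "sup_on B ((a' + b') - (a + b)) < e" if "a' \<in> ?V a" "b' \<in> ?V b" for a' b'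
  proof -
    have "sup_on B ((a' - a) + (b' - b)) \<le> sup_on B (a' - a) + sup_on B (b' - b)"
      using that a b by (intro sup_on_add 2 fun_scale.subspace_diff[OF subspace_dual_union]) auto
    also have "\<dots> < e" using that by simp
    finally show ?thesis by (simp add: algebra_simps)
  qed
  have "openin (prod_topology (strong_dual_topology smul nrm) (strong_dual_topology smul nrm)) (?V a \<times> ?V b)"
    using 2(3) by (simp add: openin_prod_Times_iff openin_strong_dual_ball a b 2(2) del: less_divide_eq_numeral1)
  moreover have "z \<in> ?V a \<times> ?V b"
    using 2(2,3) a b by (simp add: z sup_on_def)
  ultimately show ?case
    using bound by (intro exI[of _ "?V a \<times> ?V b"]) (auto simp: z)
qed

lemma continuous_map_dual_scale:
  "continuous_map (prod_topology euclidean (strong_dual_topology smul nrm))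
     (strong_dual_topology smul nrm) (\<lambda>(c, a). fun_scale c a)"
proof (rule continuous_map_strong_dualI, goal_cases)
  case (1 z)
  then show ?case
    by (auto simp: topspace_strong_dual intro: fun_scale.subspace_scale[OF subspace_dual_union])
next
  case (2 z B e)
  let ?D = "dual_union smul nrm"
  obtain c a where z: "z = (c, a)" and a: "a \<in> ?D"
    using 2(1) by (auto simp: topspace_strong_dual)
  define s where "s = sup_on B a"
  \<comment> \<open>For \<open>r \<le> 1\<close> the modulus of \<open>c'\<close> is at most
    \<open>cmod c + 1\<close>, so splitting the increment as \<open>c' (a' - a) + (c' - c) a\<close>
    bounds it by \<open>(cmod c + 1) * r + r * s = r * k\<close>.\<close>
  define k where "k = cmod c + 1 + s"
  have k: "0 \<le> s" "0 < k"
    using sup_on_nonneg[OF a 2(2)] by (auto simp: s_def k_def add_nonneg_pos add_pos_nonneg)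
  define r where "r = min 1 (e / (2 * k))"
  have r: "0 < r" "r \<le> 1" "r * k < e"
  proof -
    show "0 < r" "r \<le> 1" using k 2(3) by (auto simp: r_def)
    have "r * k \<le> (e / (2 * k)) * k"
      using k by (intro mult_right_mono) (auto simp: r_def)
    also have "\<dots> = e / 2" using k by (simp add: field_simps)
    finally show "r * k < e" using 2(3) by simp
  qed
  let ?V = "ball c r \<times> {g \<in> ?D. sup_on B (g - a) < r}"
  have bound: "sup_on B (fun_scale c' a' - fun_scale c a) < e" if "(c', a') \<in> ?V" for c' a'
  proof -
    have D: "a' - a \<in> ?D" using that a fun_scale.subspace_diff[OF subspace_dual_union] by blast
    have cc: "cmod (c' - c) \<le> r" using that by (simp add: dist_norm norm_minus_commute)
    then have c': "cmod c' \<le> cmod c + 1" using norm_triangle_sub[of c' c] r(2) by simp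
    have "fun_scale c' a' - fun_scale c a = fun_scale c' (a' - a) + fun_scale (c' - c) a"
      by (simp add: fun_scale_def fun_eq_iff algebra_simps)
    then have "sup_on B (fun_scale c' a' - fun_scale c a)
        \<le> sup_on B (fun_scale c' (a' - a)) + sup_on B (fun_scale (c' - c) a)"
      using sup_on_add[OF _ _ 2(2)] fun_scale.subspace_scale[OF subspace_dual_union] D a by simp
    also have "\<dots> \<le> cmod c' * sup_on B (a' - a) + cmod (c' - c) * s"
      unfolding s_def by (intro add_mono sup_on_scale D a 2)
    also have "\<dots> \<le> (cmod c + 1) * r + r * s"
      using that cc c' k(1) sup_on_nonneg[OF D 2(2)] by (intro add_mono mult_mono) auto
    also have "\<dots> = r * k" by (simp add: k_def algebra_simps)
    finally show ?thesis using r(3) by simp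
  qed
  have "openin (prod_topology euclidean (strong_dual_topology smul nrm)) ?V"
    by (simp add: openin_prod_Times_iff openin_strong_dual_ball a 2(2) r(1))
  moreover have "z \<in> ?V"
    using 2(2) r(1) a by (simp add: z sup_on_def)
  ultimately show ?case
    using bound by (intro exI[of _ ?V]) (auto simp: z)
qed

end

theorem theorem2p3:
  fixes smul :: "complex \<Rightarrow> 'a::ab_group_add \<Rightarrow> 'a"
    and nrm :: "nat \<Rightarrow> 'a \<Rightarrow> real"
    and prd :: "('a \<Rightarrow> complex) \<Rightarrow> ('a \<Rightarrow> complex) \<Rightarrow> ('a \<Rightarrow> complex)"
  assumes "strong_algebra smul nrm prd"
  shows "continuous_map
           (prod_topology (strong_dual_topology smul nrm) (strong_dual_topology smul nrm))
           (strong_dual_topology smul nrm) (\<lambda>(a, b). prd a b)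
       \<and> topological_complex_algebra_on fun_scale (dual_union smul nrm)
           (strong_dual_topology smul nrm) prd"
proof -
  interpret strong_algebra smul nrm prd by fact
  show ?thesis
    unfolding topological_complex_algebra_on_def
    by (intro conjI algebra topspace_strong_dual continuous_map_prd
        continuous_map_dual_add continuous_map_dual_scale)
qed

end
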